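(* Let $T>0$, let $\mathbb{U}\subset\mathbb{R}^m$ be compact and non-empty, and let $f:[0,T]\times\mathbb{R}^n\times\mathbb{U}\to\mathbb{R}^n$ be continuous, Lipschitz continuous in $x$ uniformly in $(s,u)$, and such that $f(s,x,\mathbb{U})=\{f(s,x,u)\,|\,u\in\mathbb{U}\}$ is convex for every $(s,x)\in[0,T]\times\mathbb{R}^n$. Let $g\in C(\mathbb{R}^n;\mathbb{R})$ and $\mathcal{X}=\{x\in\mathbb{R}^n\,|\,g(x)\le 0\}$. Let $\overline{v}\in C([0,T]\times\mathbb{R}^n;\mathbb{R})$ be a viscosity supersolution of $-v_t+H(t,x,\nabla v)=0$ on $\Omega=\{(t,x)\in(0,T)\times\mathbb{R}^n\,|\,\overline{v}(t,x)<0\}$, with $\overline{v}(T,x)=\overline{g}(x)$ for all $x\in\mathbb{R}^n$. If $x\mapsto\overline{v}(t,x)$ is of class $\mathcal{Z}$ for every $t\in[0,T]$ and $\overline{g}(x)>0$ for all $x\notin\mathcal{X}$, then for every $t\in[0,T]$, $$\underline{\mathcal{G}}(t):=\{x\in\mathbb{R}^n\,|\,\overline{v}(t,x)\le 0\}\subseteq\mathcal{G}(t).$$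
   Context: For $t\in[0,T]$, $\mathcal{U}[t,T]$ is the set of measurable maps $u:[t,T]\to\mathbb{U}$. For $x\in\mathbb{R}^n$ and $u\in\mathcal{U}[t,T]$, $\varphi(\cdot;t,x,u)$ denotes the unique (absolutely continuous) solution of $\dot{x}(s)=f(s,x(s),u(s))$ for a.e. $s\in(t,T)$, $x(t)=x$. The backwards reachable set is $\mathcal{G}(t)=\{x\in\mathbb{R}^n\,|\,\exists u\in\mathcal{U}[t,T]\text{ with }\varphi(T;t,x,u)\in\mathcal{X}\}$. The Hamiltonian is $H(t,x,p)=\max_{u\in\mathbb{U}}\langle -p,f(t,x,u)\rangle$. For an open set $\Omega\subseteq(0,T)\times\mathbb{R}^n$, a function $v\in C([0,T]\times\mathbb{R}^n;\mathbb{R})$ is a viscosity supersolution (resp. subsolution) of $-v_t+H(t,x,\nabla v)=0$ on $\Omega$ if for every $\xi\in C^1(\Omega;\mathbb{R})$ such that $v-\xi$ attains a local minimum (resp. local maximum) at $(t_0,x_0)\in\Omega$, one has $-\xi_t(t_0,x_0)+H(t_0,x_0,\nabla\xi(t_0,x_0))\ge 0$ (resp. $\le 0$). A function $z:\mathbb{R}^n\to\mathbb{R}$ is of class $\mathcal{Z}$ if for every $\bar{x}$ with $z(\bar{x})=0$ and every $r>0$ there exists $x$ with $\|x-\bar{x}\|<r$ and $z(x)<0$. *)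

theory Defs
  imports "HOL-Analysis.Analysis"
begin

definition abs_continuous_on :: "real set \<Rightarrow> (real \<Rightarrow> 'a::real_normed_vector) \<Rightarrow> bool" where
  "abs_continuous_on S y \<longleftrightarrow>
     (\<forall>e>0. \<exists>d>0. \<forall>D. finite D \<and>
        (\<forall>(a,b)\<in>D. a \<le> b \<and> {a..b} \<subseteq> S) \<and>
        (\<forall>(a,b)\<in>D. \<forall>(a',b')\<in>D. (a,b) \<noteq> (a',b') \<longrightarrow> {a<..<b} \<inter> {a'<..<b'} = {}) \<and>
        (\<Sum>(a,b)\<in>D. b - a) < d
        \<longrightarrow> (\<Sum>(a,b)\<in>D. norm (y b - y a)) < e)"

definition controls :: "'b::euclidean_space set \<Rightarrow> real \<Rightarrow> real \<Rightarrow> (real \<Rightarrow> 'b) set" where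
  "controls U t T = {u. u \<in> borel_measurable (lebesgue_on {t..T}) \<and> (\<forall>s\<in>{t..T}. u s \<in> U)}"

definition is_trajectory ::
  "(real \<Rightarrow> 'a::euclidean_space \<Rightarrow> 'b \<Rightarrow> 'a) \<Rightarrow> real \<Rightarrow> real \<Rightarrow> 'a \<Rightarrow> (real \<Rightarrow> 'b) \<Rightarrow> (real \<Rightarrow> 'a) \<Rightarrow> bool" where
  "is_trajectory f t T x u y \<longleftrightarrow>
     abs_continuous_on {t..T} y \<and> y t = x \<and>
     (AE s in lebesgue. s \<in> {t<..<T} \<longrightarrow> (y has_vector_derivative f s (y s) (u s)) (at s))"

definition reach_set ::
  "(real \<Rightarrow> 'a::euclidean_space \<Rightarrow> 'b::euclidean_space \<Rightarrow> 'a) \<Rightarrow> 'b set \<Rightarrow> real \<Rightarrow> ('a \<Rightarrow> real) \<Rightarrow> real \<Rightarrow> 'a set" where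
  "reach_set f U T g t = {x. \<exists>u\<in>controls U t T. \<exists>y. is_trajectory f t T x u y \<and> g (y T) \<le> 0}"

definition hamiltonian ::
  "(real \<Rightarrow> 'a::euclidean_space \<Rightarrow> 'b \<Rightarrow> 'a) \<Rightarrow> 'b set \<Rightarrow> real \<Rightarrow> 'a \<Rightarrow> 'a \<Rightarrow> real" where
  "hamiltonian f U t x p = (SUP u\<in>U. (- p) \<bullet> f t x u)"

definition C1_with_derivs ::
  "(real \<times> 'a::euclidean_space) set \<Rightarrow> (real \<Rightarrow> 'a \<Rightarrow> real) \<Rightarrow> (real \<times> 'a \<Rightarrow> real) \<Rightarrow> (real \<times> 'a \<Rightarrow> 'a) \<Rightarrow> bool" where
  "C1_with_derivs \<Omega> \<xi> \<xi>t \<xi>x \<longleftrightarrow>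
     continuous_on \<Omega> \<xi>t \<and> continuous_on \<Omega> \<xi>x \<and>
     (\<forall>(t,x)\<in>\<Omega>. ((\<lambda>(s,y). \<xi> s y) has_derivative (\<lambda>(h,k). \<xi>t (t,x) * h + \<xi>x (t,x) \<bullet> k)) (at (t,x)))"

definition viscosity_supersolution ::
  "(real \<Rightarrow> 'a::euclidean_space \<Rightarrow> 'b \<Rightarrow> 'a) \<Rightarrow> 'b set \<Rightarrow> (real \<times> 'a) set \<Rightarrow> (real \<Rightarrow> 'a \<Rightarrow> real) \<Rightarrow> bool" where
  "viscosity_supersolution f U \<Omega> v \<longleftrightarrow>
     (\<forall>\<xi> \<xi>t \<xi>x t0 x0. C1_with_derivs \<Omega> \<xi> \<xi>t \<xi>x \<and> (t0,x0) \<in> \<Omega> \<and>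
        (\<exists>e>0. \<forall>(t,x)\<in>ball (t0,x0) e \<inter> \<Omega>. v t x - \<xi> t x \<ge> v t0 x0 - \<xi> t0 x0)
        \<longrightarrow> - \<xi>t (t0,x0) + hamiltonian f U t0 x0 (\<xi>x (t0,x0)) \<ge> 0)"

definition class_Z :: "('a::real_normed_vector \<Rightarrow> real) \<Rightarrow> bool" where
  "class_Z z \<longleftrightarrow> (\<forall>xb. z xb = 0 \<longrightarrow> (\<forall>r>0. \<exists>x. norm (x - xb) < r \<and> z x < 0))"

end

theory Submission
  imports Defs "HOL-Analysis.Analysis" "HOL-Complex_Analysis.Great_Picard"
begin

text \<open>A supersolution can be followed downhill: replace \<open>v\<close> by the inf-convolution
  \<open>W(t,x) = min (v(s,y) + ((t - s)\<^sup>2 + |x - y|\<^sup>2) / (2\<epsilon>))\<close>. At a minimiser \<open>(s,y)\<close> the viscosity inequality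
  gives \<open>u\<close> with \<open>(t - s) + (x - y) \<bullet> f s y u \<le> 0\<close>, so an Euler step of length \<open>h\<close> with velocity \<open>f s y u\<close>
  raises \<open>W\<close> by at most \<open>O(h\<^sup>2 / \<epsilon>)\<close>. With \<open>h\<close> much smaller than \<open>\<epsilon>\<close> the polygon started where \<open>v < 0\<close> stays
  near points with \<open>v < 0\<close>, that is, near the region on which \<open>v\<close> is a supersolution. Class \<open>\<Z>\<close> provides such
  starting points arbitrarily close to any \<open>x\<close> with \<open>v(t,x) \<le> 0\<close>. A uniform limit of the polygons is a
  Lipschitz curve whose derivative lies in the convex compact set \<open>f s (y s) ` U\<close>, a measurable
  selection gives the control, and \<open>v(T, y T) \<le> 0\<close> forces \<open>g (y T) \<le> 0\<close>.\<close>

section \<open>Almost everywhere differentiability of Lipschitz curves\<close>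

text \<open>The lower bound makes \<open>G\<close> an increasing homeomorphism of the line. Lebesgue
  measure transported by its inverse gives \<open>{a..b}\<close> the mass \<open>G b - G a\<close>,
  and Radon-Nikodym turns this mass into an integral.\<close>

lemma biLipschitz_indefinite_integral:
  fixes G :: "real \<Rightarrow> real"
  assumes mono: "\<And>x y. x \<le> y \<Longrightarrow> y - x \<le> G y - G x"
    and lip: "\<And>x y. x \<le> y \<Longrightarrow> G y - G x \<le> K * (y - x)"
  obtains \<phi> where "\<And>a b. a \<le> b \<Longrightarrow> (\<phi> has_integral (G b - G a)) {a..b}"
proof -
  have Kn: "\<bar>G y - G x\<bar> \<le> K * \<bar>y - x\<bar>" for x y
    using mono[of x y] lip[of x y] mono[of y x] lip[of y x] by (cases "x \<le> y") auto
  have ge: "\<bar>y - x\<bar> \<le> \<bar>G y - G x\<bar>" for x y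
    using mono[of x y] mono[of y x] by (cases "x \<le> y") auto
  have contG: "continuous_on UNIV G"
  proof (rule continuous_on_subset[OF lipschitz_on_continuous_on[of "max K 0" UNIV]])
    show "(max K 0)-lipschitz_on UNIV G"
    proof (rule lipschitz_onI)
      fix x y show "dist (G x) (G y) \<le> max K 0 * dist x y"
        using Kn[of y x] by (smt (verit) dist_real_def mult_right_mono abs_ge_zero)
    qed auto
  qed auto
  have inj: "inj G"
    by (rule injI) (metis abs_le_zero_iff cancel_comm_monoid_add_class.diff_cancel ge right_minus_eq abs_zero)
  have surj: "\<exists>x. G x = z" for z
  proof -
    define a where "a = \<bar>z - G 0\<bar>"
    have "G (-a) \<le> z" "z \<le> G a"
      using mono[of "-a" 0] mono[of 0 a] unfolding a_def by auto
    then show ?thesis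
      using IVT'[of G "-a" z a] continuous_on_subset[OF contG] unfolding a_def by auto
  qed
  define H where "H = inv G"
  have GH: "G (H z) = z" for z unfolding H_def using surj by (metis f_inv_into_f rangeI)
  have HG: "H (G x) = x" for x unfolding H_def using inj by simp
  have "1-lipschitz_on UNIV H"
    by (rule lipschitz_onI) (use ge GH in \<open>auto simp: dist_real_def\<close>, metis GH ge)
  then have contH: "continuous_on UNIV H" by (rule lipschitz_on_continuous_on)
  then have Hm[measurable]: "H \<in> borel_measurable borel" by (rule borel_measurable_continuous_onI)
  have vim: "H -` A = G ` A" for A :: "real set"
    using GH HG by (auto simp: image_iff) metis
  txt \<open>\<open>N A\<close> is the length of \<open>G ` A\<close>; it vanishes on null sets because \<open>G\<close> is Lipschitz,
    so it has a density, which plays the role of the derivative of \<open>G\<close>.\<close>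
  define N where "N = distr lborel borel H"
  have "absolutely_continuous lborel N"
    unfolding absolutely_continuous_def
  proof
    fix A :: "real set" assume A: "A \<in> null_sets lborel"
    then have "negligible A" by (simp add: negligible_iff_null_sets null_sets_completionI)
    then have "negligible (G ` A)"
      by (rule negligible_locally_Lipschitz_image[rotated])
        (use Kn in \<open>auto intro!: exI[of _ UNIV] exI[of _ K]\<close>)
    moreover have "A \<in> sets borel" using A by auto
    then have "G ` A \<in> sets borel"
      unfolding vim[symmetric] using measurable_sets[OF Hm, of A] by simp
    ultimately have "emeasure lborel (G ` A) = 0"
      by (simp add: negligible_iff_null_sets null_sets_completion_iff null_setsD1)
    then show "A \<in> null_sets N"
      using \<open>A \<in> sets borel\<close> unfolding N_def by (auto simp: null_sets_def emeasure_distr vim)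
  qed
  moreover have "sets N = sets lborel" unfolding N_def by simp
  ultimately obtain f where f[measurable]: "f \<in> borel_measurable lborel" and fN: "density lborel f = N"
    using sigma_finite_measure.Radon_Nikodym[OF sigma_finite_lborel] by blast
  define \<phi> where "\<phi> x = enn2real (f x)" for x
  have "(\<phi> has_integral (G b - G a)) {a..b}" if "a \<le> b" for a b
  proof -
    have "G ` {a..b} = {G a..G b}"
    proof (intro equalityI subsetI)
      fix z assume "z \<in> {G a..G b}"
      then show "z \<in> G ` {a..b}"
        using IVT'[of G a z b] continuous_on_subset[OF contG] that by fastforce
    qed (use mono in \<open>fastforce\<close>)
    moreover have "G a \<le> G b" using mono[OF that] that by auto
    ultimately have "emeasure N {a..b} = ennreal (G b - G a)"
      unfolding N_def by (simp add: emeasure_distr vim)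
    then have *: "(\<integral>\<^sup>+x. f x * indicator {a..b} x \<partial>lborel) = ennreal (G b - G a)"
      unfolding fN[symmetric] by (simp add: emeasure_density)
    \<comment> \<open>A density may be infinite, but the mass of \<open>{a..b}\<close> is finite, so
      passing to real values changes it on a null set only.\<close>
    have "AE x in lborel. f x * indicator {a..b} x \<noteq> \<infinity>"
      by (rule nn_integral_PInf_AE) (use * in auto)
    then have "(\<integral>\<^sup>+x. ennreal (\<phi> x * indicator {a..b} x) \<partial>lborel)
        = (\<integral>\<^sup>+x. f x * indicator {a..b} x \<partial>lborel)"
      by (intro nn_integral_cong_AE, elim eventually_mono)
        (auto simp: \<phi>_def indicator_def less_top ennreal_enn2real)
    with * have "((\<lambda>x. \<phi> x * indicator {a..b} x) has_integral (G b - G a)) UNIV"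
      using \<open>G a \<le> G b\<close> unfolding \<phi>_def by (intro nn_integral_has_integral) auto
    then show ?thesis
      by (subst has_integral_restrict_UNIV[symmetric])
        (simp add: indicator_def of_bool_def if_distrib cong: if_cong)
  qed
  then show thesis using that by blast
qed

text \<open>Lebesgue differentiation for averages over \<open>{x..x+h}\<close>. These extend to the
  right of \<open>x\<close> only, hence the one-sided limit.\<close>

lemma indefinite_integral_right_derivative:
  fixes \<phi> G :: "real \<Rightarrow> real"
  assumes "\<And>a b. a \<le> b \<Longrightarrow> (\<phi> has_integral (G b - G a)) {a..b}"
  obtains N where "negligible N"
    "\<And>x. x \<notin> N \<Longrightarrow> ((\<lambda>h. (G (x + h) - G x) / h) \<longlongrightarrow> \<phi> x) (at_right 0)"
proof -
  have "\<phi> integrable_on cbox a b" for a b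
    using assms[of a b] by (cases "a \<le> b") (auto simp: integrable_on_def)
  then obtain N where N: "negligible N" and
    lim: "\<And>x e. \<lbrakk>x \<notin> N; 0 < e\<rbrakk> \<Longrightarrow> \<exists>d>0. \<forall>h. 0 < h \<and> h < d \<longrightarrow>
        norm (integral (cbox x (x + h *\<^sub>R One)) \<phi> /\<^sub>R h ^ DIM(real) - \<phi> x) < e"
    using integrable_ccontinuous_explicit[of \<phi>] by metis
  have "((\<lambda>h. (G (x + h) - G x) / h) \<longlongrightarrow> \<phi> x) (at_right 0)" if x: "x \<notin> N" for x
  proof (rule tendstoI)
    fix e :: real assume "e > 0"
    then obtain d where d: "d > 0" "\<And>h. 0 < h \<and> h < d \<Longrightarrow>
        norm (integral (cbox x (x + h *\<^sub>R One)) \<phi> /\<^sub>R h ^ DIM(real) - \<phi> x) < e"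
      using lim[OF x] by blast
    have "dist ((G (x + h) - G x) / h) (\<phi> x) < e" if "0 < h" "h < d" for h
    proof -
      have "integral {x..x+h} \<phi> = G (x + h) - G x"
        using assms[of x "x+h"] that by (simp add: integral_unique)
      then show ?thesis using d(2)[of h] that by (simp add: dist_real_def divide_inverse mult.commute)
    qed
    then show "\<forall>\<^sub>F h in at_right 0. dist ((G (x + h) - G x) / h) (\<phi> x) < e"
      using d(1) unfolding eventually_at_right_field by auto
  qed
  then show thesis using N that by blast
qed

lemma Lipschitz_real_differentiable_ae:
  fixes g :: "real \<Rightarrow> real"
  assumes lip: "\<And>x y. \<bar>g x - g y\<bar> \<le> K * \<bar>x - y\<bar>"
  shows "AE x in lebesgue. g differentiable (at x)"
proof -
  txt \<open>Adding a steep linear function makes \<open>g\<close> bi-Lipschitz. The differentiation theorem for integrals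
    is one-sided; the left derivative comes from reflecting the line.\<close>
  define G where "G x = g x + (K + 1) * x" for x
  have m: "y - x \<le> G y - G x" "G y - G x \<le> (2 * K + 1) * (y - x)" if "x \<le> y" for x y
    using lip[of x y] that by (auto simp: G_def algebra_simps abs_le_iff)
  obtain \<phi> where \<phi>: "\<And>a b. a \<le> b \<Longrightarrow> (\<phi> has_integral (G b - G a)) {a..b}"
    using biLipschitz_indefinite_integral[of G "2 * K + 1", OF m] by metis
  obtain N1 where N1: "negligible N1"
    "\<And>x. x \<notin> N1 \<Longrightarrow> ((\<lambda>h. (G (x + h) - G x) / h) \<longlongrightarrow> \<phi> x) (at_right 0)"
    using indefinite_integral_right_derivative[OF \<phi>] by metis
  have refl_int: "((\<lambda>x. \<phi> (- x)) has_integral (- G (- b) - - G (- a))) {a..b}" if "a \<le> b" for a b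
  proof -
    have "(\<phi> has_integral (G (- a) - G (- b))) {- b..- a}" using \<phi> that by auto
    then have "((\<lambda>x. \<phi> (- x)) has_integral (G (- a) - G (- b))) {- (- a)..- (- b)}"
      by (simp only: has_integral_reflect_real)
    then show ?thesis by (simp only: minus_minus minus_diff_eq diff_minus_eq_add add.commute[of "- _"] flip: diff_conv_add_uminus)
  qed
  obtain N2 where N2: "negligible N2"
    "\<And>x. x \<notin> N2 \<Longrightarrow> ((\<lambda>h. (- G (- (x + h)) - - G (- x)) / h) \<longlongrightarrow> \<phi> (- x)) (at_right 0)"
    by (rule indefinite_integral_right_derivative[of "\<lambda>x. \<phi> (- x)" "\<lambda>x. - G (- x)", OF refl_int])
      (assumption, blast intro: that)
  have "negligible (uminus ` N2)"
    by (rule negligible_locally_Lipschitz_image)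
      (use N2 in \<open>auto intro!: exI[of _ "UNIV :: real set"] exI[of _ "1 :: real"]\<close>)
  then have neg: "negligible (N1 \<union> uminus ` N2)" using N1(1) by (rule negligible_Un[rotated])
  have "g differentiable (at x)" if "x \<notin> N1 \<union> uminus ` N2" for x
  proof -
    have r: "((\<lambda>h. (G (x + h) - G x) / h) \<longlongrightarrow> \<phi> x) (at_right 0)" using N1(2) that by auto
    have "- x \<notin> N2" using that by (force simp: image_iff)
    \<comment> \<open>The right derivative of the reflected function at \<open>- x\<close> is the
      left derivative of \<open>G\<close> at \<open>x\<close>; both one-sided limits have the value
      \<open>\<phi> x\<close>.\<close>
    then have "((\<lambda>h. (- G (- (- x + h)) - - G (- (- x))) / h) \<longlongrightarrow> \<phi> (- (- x))) (at_right 0)" by (rule N2(2))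
    then have "((\<lambda>h. (- G (x - h) + G x) / h) \<longlongrightarrow> \<phi> x) (at_right 0)" by simp
    also have "(\<lambda>h. (- G (x - h) + G x) / h) = (\<lambda>h. (G (x + - h) - G x) / - h)"
      by (auto simp: fun_eq_iff diff_divide_distrib)
    finally have l: "((\<lambda>h. (G (x + h) - G x) / h) \<longlongrightarrow> \<phi> x) (at_left 0)"
      unfolding filterlim_at_left_to_right[of _ _ "0::real"] by simp
    have "((\<lambda>h. (G (x + h) - G x) / h) \<longlongrightarrow> \<phi> x) (at 0)"
      using l r by (rule filterlim_split_at)
    then have "(G has_real_derivative \<phi> x) (at x)" by (simp add: DERIV_def)
    then have "((\<lambda>x. G x - (K + 1) * x) has_real_derivative \<phi> x - (K + 1)) (at x)"
      by (auto intro!: derivative_eq_intros)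
    moreover have "(\<lambda>x. G x - (K + 1) * x) = g" by (simp add: G_def fun_eq_iff)
    ultimately show ?thesis using real_differentiable_def by metis
  qed
  then show ?thesis
    using neg unfolding negligible_iff_null_sets
    by (auto intro!: AE_I'[of "N1 \<union> uminus ` N2"])
qed

lemma has_vector_derivative_quotient_tendsto:
  fixes y :: "real \<Rightarrow> 'a::real_normed_vector"
  assumes D: "(y has_vector_derivative D) (at s)"
  shows "((\<lambda>h. (y (s + h) - y s) /\<^sub>R h) \<longlongrightarrow> D) (at 0)"
  proof (subst tendsto_norm_zero_iff[symmetric, THEN trans[OF LIM_zero_iff[symmetric]]])
    show "((\<lambda>h. norm ((y (s + h) - y s) /\<^sub>R h - D)) \<longlongrightarrow> 0) (at 0)"
    proof (rule filterlim_cong[THEN iffD1, OF refl refl])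
      show "((\<lambda>h. norm (y (s + h) - y s - h *\<^sub>R D) / norm h) \<longlongrightarrow> 0) (at 0)"
        using D unfolding has_vector_derivative_def has_derivative_at by auto
      have "norm (y (s + h) - y s - h *\<^sub>R D) / norm h = norm ((y (s + h) - y s) /\<^sub>R h - D)"
        if "h \<noteq> 0" for h
      proof -
        have "(y (s + h) - y s) /\<^sub>R h - D = (y (s + h) - y s - h *\<^sub>R D) /\<^sub>R h"
          using that by (simp add: scaleR_diff_right)
        then show ?thesis by (simp add: divide_inverse mult.commute)
      qed
      then show "\<forall>\<^sub>F h in at 0. norm (y (s + h) - y s - h *\<^sub>R D) / norm h
          = norm ((y (s + h) - y s) /\<^sub>R h - D)"
        by (auto simp: eventually_at_filter)
    qed
  qed


text \<open>Rademacher's theorem in one variable, applied to each of finitely many coordinates. A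
  Borel version of the derivative is what the selection of a control later compares with.\<close>

lemma Lipschitz_has_vector_derivative_ae:
  fixes y :: "real \<Rightarrow> 'a::euclidean_space"
  assumes lip: "\<And>s r. norm (y s - y r) \<le> K * \<bar>s - r\<bar>"
  obtains w where "w \<in> borel_measurable borel"
    "AE s in lebesgue. (y has_vector_derivative w s) (at s)"
proof -
  \<comment> \<open>\<open>lim\<close> is total, so \<open>w\<close> is Borel on the whole line;
    where \<open>y\<close> is differentiable it is the derivative.\<close>
  define w where "w s = lim (\<lambda>n. (y (s + inverse (real (Suc n))) - y s) /\<^sub>R inverse (real (Suc n)))" for s
  have "continuous_on UNIV y"
  proof (rule lipschitz_on_continuous_on)
    show "\<bar>K\<bar>-lipschitz_on UNIV y"
      by (rule lipschitz_onI)
        (auto simp: dist_norm intro!: order_trans[OF lip] mult_right_mono)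
  qed
  then have [measurable]: "y \<in> borel_measurable borel" by (rule borel_measurable_continuous_onI)
  have meas: "w \<in> borel_measurable borel" unfolding w_def by measurable
  have "AE s in lebesgue. \<forall>b\<in>Basis. (\<lambda>s. y s \<bullet> b) differentiable (at s)"
  proof (rule AE_finite_allI)
    fix b :: 'a assume "b \<in> Basis"
    then have "\<bar>y x \<bullet> b - y z \<bullet> b\<bar> \<le> K * \<bar>x - z\<bar>" for x z
      using Basis_le_norm[of b "y x - y z"] lip[of x z] by (simp add: inner_diff_left)
    then show "AE s in lebesgue. (\<lambda>s. y s \<bullet> b) differentiable (at s)"
      by (rule Lipschitz_real_differentiable_ae)
  qed simp
  then have "AE s in lebesgue. (y has_vector_derivative w s) (at s)"
  proof eventually_elim
    case (elim s)
    then have "y differentiable (at s)" using differentiable_componentwise_within[of y s UNIV] by auto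
    then obtain D where D: "(y has_vector_derivative D) (at s)"
      using vector_derivative_works by blast
    then have "((\<lambda>h. (y (s + h) - y s) /\<^sub>R h) \<longlongrightarrow> D) (at 0)"
      by (rule has_vector_derivative_quotient_tendsto)
    then have "(\<lambda>n. (y (s + inverse (real (Suc n))) - y s) /\<^sub>R inverse (real (Suc n))) \<longlonglongrightarrow> D"
      by (rule filterlim_compose)
        (use LIMSEQ_inverse_real_of_nat in \<open>auto simp: filterlim_at simp del: of_nat_Suc\<close>)
    then have "w s = D" unfolding w_def by (rule limI)
    then show ?case using D by simp
  qed
  then show thesis using meas that by blast
qed

section \<open>Measurable selection of zeros\<close>

text \<open>By continuity and compactness a zero exists iff the values on a countable dense subset
  come arbitrarily close to 0, which is a countable condition.\<close>

lemma measurable_zero_exists: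
  fixes \<phi> :: "'s \<Rightarrow> 'b::euclidean_space \<Rightarrow> real"
  assumes C: "compact C"
    and meas: "\<And>u. u \<in> C \<Longrightarrow> (\<lambda>s. \<phi> s u) \<in> borel_measurable M"
    and cont: "\<And>s. s \<in> space M \<Longrightarrow> continuous_on C (\<phi> s)"
    and nonneg: "\<And>s u. s \<in> space M \<Longrightarrow> u \<in> C \<Longrightarrow> 0 \<le> \<phi> s u"
  shows "{s \<in> space M. \<exists>u\<in>C. \<phi> s u = 0} \<in> sets M"
proof -
  obtain D where D: "countable D" "D \<subseteq> C" "C \<subseteq> closure D"
    using separable by blast
  have "{s \<in> space M. \<exists>u\<in>C. \<phi> s u = 0} =
      {s \<in> space M. \<forall>n. \<exists>d\<in>D. \<phi> s d < inverse (real (Suc n))}"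
  proof (intro Collect_cong conj_cong refl iffI allI)
    fix s n assume s: "s \<in> space M" and "\<exists>u\<in>C. \<phi> s u = 0"
    then obtain u where u: "u \<in> C" "\<phi> s u = 0" by blast
    then obtain r where r: "r > 0" "\<And>x. x \<in> C \<Longrightarrow> dist x u < r \<Longrightarrow> dist (\<phi> s x) (\<phi> s u) < inverse (real (Suc n))"
      using cont[OF s] unfolding continuous_on_iff by (metis inverse_positive_iff_positive of_nat_0_less_iff zero_less_Suc)
    obtain d where "d \<in> D" "dist d u < r"
      using D(3) u(1) r(1) closure_approachable[of u D] by auto
    then show "\<exists>d\<in>D. \<phi> s d < inverse (real (Suc n))"
      using r(2)[of d] D(2) u(2) by (intro bexI[of _ d]) (auto simp: dist_real_def)
  next
    fix s assume s: "s \<in> space M" and *: "\<forall>n. \<exists>d\<in>D. \<phi> s d < inverse (real (Suc n))"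
    have "C \<noteq> {}" using * D(2) by blast
    then obtain u where u: "u \<in> C" "\<And>x. x \<in> C \<Longrightarrow> \<phi> s u \<le> \<phi> s x"
      using continuous_attains_inf[OF C _ cont[OF s]] by blast
    have "\<phi> s u \<le> 0"
    proof (rule ccontr)
      assume "\<not> \<phi> s u \<le> 0"
      then obtain n where "inverse (real (Suc n)) < \<phi> s u" using reals_Archimedean[of "\<phi> s u"] by auto
      moreover obtain d where "d \<in> D" "\<phi> s d < inverse (real (Suc n))" using * by blast
      moreover have "\<phi> s u \<le> \<phi> s d" using u(2) D(2) \<open>d \<in> D\<close> by blast
      ultimately show False by linarith
    qed
    then show "\<exists>u\<in>C. \<phi> s u = 0" using u(1) nonneg[OF s] by force
  qed
  also have "\<dots> = (\<Inter>n. \<Union>d\<in>D. {s \<in> space M. \<phi> s d < inverse (real (Suc n))})" by auto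
  also have "\<dots> \<in> sets M"
  proof (intro sets.countable_INT image_subsetI sets.countable_UN'')
    fix n d assume "d \<in> D"
    then have [measurable]: "(\<lambda>s. \<phi> s d) \<in> borel_measurable M" using D(2) meas by auto
    show "{s \<in> space M. \<phi> s d < inverse (real (Suc n))} \<in> sets M" by measurable
  qed (use D in auto)
  finally show ?thesis .
qed

text \<open>Minimising the coordinates one after another over the compact set of zeros picks its
  lexicographically least element; each minimum is a measurable function.\<close>
lemma measurable_zero_coordinates:
  fixes \<phi> :: "'s \<Rightarrow> 'b::euclidean_space \<Rightarrow> real"
  assumes U: "compact U"
    and meas: "\<And>u. u \<in> U \<Longrightarrow> (\<lambda>s. \<phi> s u) \<in> borel_measurable M"
    and cont: "\<And>s. s \<in> space M \<Longrightarrow> continuous_on U (\<phi> s)"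
    and nonneg: "\<And>s u. s \<in> space M \<Longrightarrow> u \<in> U \<Longrightarrow> 0 \<le> \<phi> s u"
    and ex: "\<And>s. s \<in> space M \<Longrightarrow> \<exists>u\<in>U. \<phi> s u = 0"
    and "finite B"
  shows "\<exists>m. (\<forall>b\<in>B. m b \<in> borel_measurable M) \<and>
    (\<forall>s\<in>space M. \<exists>u\<in>U. \<phi> s u = 0 \<and> (\<forall>b\<in>B. u \<bullet> b = m b s))"
  using \<open>finite B\<close>
proof induction
  case empty
  then show ?case using ex by auto
next
  case (insert c B)
  then obtain m where m: "\<And>b. b \<in> B \<Longrightarrow> m b \<in> borel_measurable M"
    "\<And>s. s \<in> space M \<Longrightarrow> \<exists>u\<in>U. \<phi> s u = 0 \<and> (\<forall>b\<in>B. u \<bullet> b = m b s)"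
    by blast
  \<comment> \<open>The coordinates already fixed enter as penalties: the zeros of
    \<open>\<psi> s\<close> are the zeros of \<open>\<phi> s\<close> with exactly these
    coordinates.\<close>
  define \<psi> where "\<psi> s u = \<phi> s u + (\<Sum>b\<in>B. \<bar>u \<bullet> b - m b s\<bar>)" for s u
  have \<psi>_meas: "(\<lambda>s. \<psi> s u) \<in> borel_measurable M" if "u \<in> U" for u
    unfolding \<psi>_def using meas[OF that] m(1)
    by (intro borel_measurable_add borel_measurable_sum borel_measurable_abs borel_measurable_diff) auto
  have \<psi>_cont: "continuous_on U (\<psi> s)" if "s \<in> space M" for s
    unfolding \<psi>_def using cont[OF that] by (intro continuous_intros)
  have \<psi>_0: "\<psi> s u = 0 \<longleftrightarrow> \<phi> s u = 0 \<and> (\<forall>b\<in>B. u \<bullet> b = m b s)"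
    if "s \<in> space M" "u \<in> U" for s u
    unfolding \<psi>_def using nonneg[OF that] insert.hyps(1)
    by (subst add_nonneg_eq_0_iff) (auto simp: sum_nonneg_eq_0_iff sum_nonneg)
  have \<psi>_nonneg: "0 \<le> \<psi> s u" if "s \<in> space M" "u \<in> U" for s u
    unfolding \<psi>_def using nonneg[OF that] by (simp add: sum_nonneg)
  define Z where "Z s = {u\<in>U. \<psi> s u = 0}" for s
  have Zc: "compact (Z s)" if "s \<in> space M" for s
  proof -
    have "closedin (top_of_set U) (U \<inter> \<psi> s -` {0})"
      by (rule continuous_closedin_preimage[OF \<psi>_cont[OF that]]) auto
    moreover have "U \<inter> \<psi> s -` {0} = Z s" unfolding Z_def by auto
    ultimately show ?thesis using U closedin_compact by metis
  qed
  have Zne: "Z s \<noteq> {}" if "s \<in> space M" for s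
    using m(2)[OF that] \<psi>_0[OF that] unfolding Z_def by auto
  define k where "k s = Inf ((\<lambda>u. u \<bullet> c) ` Z s)" for s
  have k_min: "\<exists>u\<in>Z s. u \<bullet> c = k s \<and> (\<forall>z\<in>Z s. k s \<le> z \<bullet> c)" if s: "s \<in> space M" for s
  proof -
    have "continuous_on (Z s) (\<lambda>u. u \<bullet> c)" by (intro continuous_intros)
    then obtain u where u: "u \<in> Z s" "\<And>z. z \<in> Z s \<Longrightarrow> u \<bullet> c \<le> z \<bullet> c"
      using continuous_attains_inf[OF Zc[OF s] Zne[OF s]] by blast
    then have "k s = u \<bullet> c" unfolding k_def by (intro cInf_eq_minimum) auto
    then show ?thesis using u by auto
  qed
  have k_meas: "k \<in> borel_measurable M"
  proof (rule borel_measurable_iff_le[THEN iffD2], rule allI)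
    fix a
    \<comment> \<open>The minimum \<open>k s\<close> is at most \<open>a\<close> exactly when
      \<open>\<psi> s\<close> has a zero on the compact slice \<open>u \<bullet> c \<le> a\<close>,
      which is a measurable condition on \<open>s\<close>.\<close>
    have cl: "closed {u. u \<bullet> c \<le> a}"
      by (simp add: closed_Collect_le continuous_on_inner)
    have "{s \<in> space M. \<exists>u\<in>U \<inter> {u. u \<bullet> c \<le> a}. \<psi> s u = 0} \<in> sets M"
      by (rule measurable_zero_exists)
        (use U cl \<psi>_meas \<psi>_nonneg in \<open>auto intro: compact_Int_closed continuous_on_subset[OF \<psi>_cont]\<close>)
    moreover have "k s \<le> a \<longleftrightarrow> (\<exists>u\<in>U \<inter> {u. u \<bullet> c \<le> a}. \<psi> s u = 0)" if "s \<in> space M" for s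
      using k_min[OF that] unfolding Z_def by force
    ultimately show "{w \<in> space M. k w \<le> a} \<in> sets M" by (simp cong: conj_cong)
  qed
  have "\<exists>u\<in>U. \<phi> s u = 0 \<and> (\<forall>b\<in>insert c B. u \<bullet> b = (m(c := k)) b s)" if s: "s \<in> space M" for s
    using k_min[OF s] \<psi>_0[OF s] insert.hyps(2) unfolding Z_def by fastforce
  moreover have "\<forall>b\<in>insert c B. (m(c := k)) b \<in> borel_measurable M" using m(1) k_meas by auto
  ultimately show ?case by blast
qed

text \<open>Prescribing the coordinates along the whole basis leaves a single point of
  \<open>U\<close>, and it depends measurably on \<open>s\<close>.\<close>

lemma measurable_zero_selection:
  fixes \<phi> :: "'s \<Rightarrow> 'b::euclidean_space \<Rightarrow> real"
  assumes U: "compact U" "U \<noteq> {}"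
    and meas: "\<And>u. u \<in> U \<Longrightarrow> (\<lambda>s. \<phi> s u) \<in> borel_measurable M"
    and cont: "\<And>s. s \<in> space M \<Longrightarrow> continuous_on U (\<phi> s)"
    and nonneg: "\<And>s u. s \<in> space M \<Longrightarrow> u \<in> U \<Longrightarrow> 0 \<le> \<phi> s u"
  obtains h where "h \<in> borel_measurable M" "\<And>s. s \<in> space M \<Longrightarrow> h s \<in> U"
    "\<And>s. s \<in> space M \<Longrightarrow> \<exists>u\<in>U. \<phi> s u = 0 \<Longrightarrow> \<phi> s (h s) = 0"
proof -
  define G where "G = {s \<in> space M. \<exists>u\<in>U. \<phi> s u = 0}"
  have [measurable]: "G \<in> sets M"
    unfolding G_def by (rule measurable_zero_exists[OF U(1) meas cont nonneg])
  \<comment> \<open>The indicator turns every point of \<open>U\<close> into a zero when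
    \<open>\<phi> s\<close> has none, so that zeros exist for all \<open>s\<close>; on
    \<open>G\<close> nothing changes.\<close>
  define \<psi> where "\<psi> s u = indicator G s * \<phi> s u" for s u
  have "\<exists>m. (\<forall>b\<in>Basis. m b \<in> borel_measurable M) \<and>
    (\<forall>s\<in>space M. \<exists>u\<in>U. \<psi> s u = 0 \<and> (\<forall>b\<in>Basis. u \<bullet> b = m b s))"
  proof (rule measurable_zero_coordinates[OF U(1)])
    fix u assume "u \<in> U"
    note [measurable] = meas[OF this]
    show "(\<lambda>s. \<psi> s u) \<in> borel_measurable M" unfolding \<psi>_def by measurable
  next
    fix s assume s: "s \<in> space M"
    show "continuous_on U (\<psi> s)" unfolding \<psi>_def using cont[OF s] by (intro continuous_intros)
    show "\<exists>u\<in>U. \<psi> s u = 0" using U(2) s by (cases "s \<in> G") (auto simp: \<psi>_def G_def)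
    show "0 \<le> \<psi> s u" if "u \<in> U" for u unfolding \<psi>_def using nonneg[OF s that] by simp
  qed simp
  then obtain m where m: "\<And>b. b \<in> Basis \<Longrightarrow> m b \<in> borel_measurable M"
    "\<And>s. s \<in> space M \<Longrightarrow> \<exists>u\<in>U. \<psi> s u = 0 \<and> (\<forall>b\<in>Basis. u \<bullet> b = m b s)" by blast
  define h where "h s = (\<Sum>b\<in>Basis. m b s *\<^sub>R b)" for s
  have h: "h s \<in> U \<and> \<psi> s (h s) = 0" if s: "s \<in> space M" for s
  proof -
    obtain u where u: "u \<in> U" "\<psi> s u = 0" "\<And>b. b \<in> Basis \<Longrightarrow> u \<bullet> b = m b s" using m(2)[OF s] by blast
    have "h s = u" unfolding h_def using u(3) euclidean_representation[of u] by simp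
    then show ?thesis using u by simp
  qed
  show thesis
  proof
    show "h \<in> borel_measurable M" unfolding h_def
      using m(1) by (intro borel_measurable_sum borel_measurable_scaleR) auto
    show "h s \<in> U" if "s \<in> space M" for s using h[OF that] by simp
    show "\<phi> s (h s) = 0" if "s \<in> space M" "\<exists>u\<in>U. \<phi> s u = 0" for s
      using h[OF that(1)] that unfolding \<psi>_def G_def by auto
  qed
qed

section \<open>Limits of approximate trajectories\<close>

text \<open>\<open>1 \<le> L\<close> costs nothing, as a Lipschitz constant may be enlarged, and it
  permits division by \<open>L\<close> in the growth bound. Terminal data and class
  \<open>\<Z>\<close> enter only in the final theorem.\<close>

locale hj_supersolution =
  fixes T L :: real
    and U :: "'b::euclidean_space set"
    and f :: "real \<Rightarrow> 'a::euclidean_space \<Rightarrow> 'b \<Rightarrow> 'a"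
    and v :: "real \<Rightarrow> 'a \<Rightarrow> real"
  assumes T_pos: "0 < T"
    and U_compact: "compact U" and U_nonempty: "U \<noteq> {}"
    and f_cont: "continuous_on ({0..T} \<times> UNIV \<times> U) (\<lambda>(s,x,u). f s x u)"
    and L_ge_1: "1 \<le> L"
    and f_lip: "\<lbrakk>s \<in> {0..T}; u \<in> U\<rbrakk> \<Longrightarrow> norm (f s x u - f s y u) \<le> L * norm (x - y)"
    and f_convex: "s \<in> {0..T} \<Longrightarrow> convex (f s x ` U)"
    and v_cont: "continuous_on ({0..T} \<times> UNIV) (\<lambda>(t,x). v t x)"
    and v_super: "viscosity_supersolution f U {(t,x). t \<in> {0<..<T} \<and> v t x < 0} v"
begin

text \<open>Testing difference quotients against convex sets of nearby velocities expresses that \<open>Y\<close> almost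
  solves the differential inclusion; unlike a condition on derivatives, this passes to pointwise limits.\<close>
definition approx_trajectory :: "real \<Rightarrow> real \<Rightarrow> real \<Rightarrow> real \<Rightarrow> (real \<Rightarrow> 'a) \<Rightarrow> bool" where
  "approx_trajectory M \<eta> a b Y \<longleftrightarrow>
     (\<forall>s r. norm (Y s - Y r) \<le> M * \<bar>s - r\<bar>) \<and>
     (\<forall>s r K. a \<le> s \<and> s < r \<and> r \<le> b \<and> convex K \<and>
        (\<forall>\<sigma> z u. \<sigma> \<in> {0..T} \<and> \<bar>\<sigma> - s\<bar> \<le> (r - s) + \<eta> \<and> norm (z - Y s) \<le> M * (r - s) + \<eta> \<and> u \<in> U
           \<longrightarrow> f \<sigma> z u \<in> K)
        \<longrightarrow> (Y r - Y s) /\<^sub>R (r - s) \<in> K)"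

end

lemma Lipschitz_imp_abs_continuous_on:
  assumes "\<And>s r. norm (y s - y r) \<le> M * \<bar>s - r\<bar>"
  shows "abs_continuous_on S y"
  unfolding abs_continuous_on_def
proof (intro allI impI)
  fix e :: real assume "e > 0"
  have "0 \<le> M" using order_trans[OF norm_ge_zero assms[of 1 0]] by simp
  show "\<exists>d>0. \<forall>D. finite D \<and> (\<forall>(a, b)\<in>D. a \<le> b \<and> {a..b} \<subseteq> S) \<and>
      (\<forall>(a, b)\<in>D. \<forall>(a', b')\<in>D. (a, b) \<noteq> (a', b') \<longrightarrow> {a<..<b} \<inter> {a'<..<b'} = {}) \<and>
      (\<Sum>(a, b)\<in>D. b - a) < d \<longrightarrow> (\<Sum>(a, b)\<in>D. norm (y b - y a)) < e"
  proof (intro exI[of _ "e / (M + 1)"] conjI allI impI)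
    show "0 < e / (M + 1)" using \<open>e > 0\<close> \<open>0 \<le> M\<close> by simp
    fix D assume D: "finite D \<and> (\<forall>(a, b)\<in>D. a \<le> b \<and> {a..b} \<subseteq> S) \<and>
      (\<forall>(a, b)\<in>D. \<forall>(a', b')\<in>D. (a, b) \<noteq> (a', b') \<longrightarrow> {a<..<b} \<inter> {a'<..<b'} = {}) \<and>
      (\<Sum>(a, b)\<in>D. b - a) < e / (M + 1)"
    have "(\<Sum>(a, b)\<in>D. norm (y b - y a)) \<le> (\<Sum>(a, b)\<in>D. M * (b - a))"
    proof (rule sum_mono, clarify)
      fix a b assume "(a, b) \<in> D"
      then have "a \<le> b" using D by auto
      then show "norm (y b - y a) \<le> M * (b - a)" using assms[of b a] by simp
    qed
    also have "\<dots> = M * (\<Sum>(a, b)\<in>D. b - a)" by (simp add: sum_distrib_left case_prod_unfold)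
    also have "\<dots> \<le> M * (e / (M + 1))" using D \<open>0 \<le> M\<close> by (intro mult_left_mono) auto
    also have "\<dots> < e" using \<open>e > 0\<close> \<open>0 \<le> M\<close> by (simp add: field_simps)
    finally show "(\<Sum>(a, b)\<in>D. norm (y b - y a)) < e" .
  qed
qed

context hj_supersolution
begin

text \<open>Uniformity in \<open>u\<close> comes from uniform continuity of \<open>f\<close> on a
  compact set, with the space variable in the unit ball around \<open>x\<close>.\<close>

lemma f_uniformly_near:
  assumes s: "s \<in> {0..T}" and "e > 0"
  obtains \<rho> where "\<rho> > 0"
    "\<And>\<sigma> z u. \<lbrakk>\<sigma> \<in> {0..T}; \<bar>\<sigma> - s\<bar> \<le> \<rho>; norm (z - x) \<le> \<rho>; u \<in> U\<rbrakk> \<Longrightarrow> norm (f \<sigma> z u - f s x u) < e"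
proof -
  let ?C = "{0..T} \<times> cball x 1 \<times> U"
  have "uniformly_continuous_on ?C (\<lambda>(s,x,u). f s x u)"
    using U_compact by (intro compact_uniformly_continuous continuous_on_subset[OF f_cont] compact_Times) auto
  then obtain d where d: "d > 0" "\<And>p q. \<lbrakk>p \<in> ?C; q \<in> ?C; dist q p < d\<rbrakk> \<Longrightarrow>
      dist ((\<lambda>(s,x,u). f s x u) q) ((\<lambda>(s,x,u). f s x u) p) < e"
    using \<open>e > 0\<close> unfolding uniformly_continuous_on_def by metis
  show thesis
  proof (rule that[of "min 1 (d / 3)"])
    show "min 1 (d / 3) > 0" using d(1) by simp
    fix \<sigma> z u assume *: "\<sigma> \<in> {0..T}" "\<bar>\<sigma> - s\<bar> \<le> min 1 (d / 3)" "norm (z - x) \<le> min 1 (d / 3)" "u \<in> U"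
    have "dist (\<sigma>, z, u) (s, x, u) \<le> dist \<sigma> s + dist z x"
      unfolding dist_Pair_Pair using sqrt_sum_squares_le_sum[of "dist \<sigma> s" "dist z x"] by simp
    also have "\<dots> < d" using * d(1) by (auto simp: dist_real_def dist_norm)
    finally have "dist (\<sigma>, z, u) (s, x, u) < d" .
    with d(2)[of "(s, x, u)" "(\<sigma>, z, u)"] s * show "norm (f \<sigma> z u - f s x u) < e"
      by (auto simp: dist_norm norm_minus_commute)
  qed
qed

lemma f_image_compact: "s \<in> {0..T} \<Longrightarrow> compact (f s x ` U)"
proof (rule compact_continuous_image[OF _ U_compact])
  assume s: "s \<in> {0..T}"
  have "continuous_on U (\<lambda>u. (\<lambda>(s,x,u). f s x u) (s, x, u))"
    by (rule continuous_on_compose2[OF f_cont]) (use s in \<open>auto intro!: continuous_intros\<close>)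
  then show "continuous_on U (f s x)" by simp
qed

text \<open>Velocities at points near \<open>(s, y s)\<close> lie in a closed convex neighbourhood
  of the image of \<open>U\<close> under \<open>f s (y s)\<close>, hence so do difference quotients
  of \<open>Y n\<close>. Letting first \<open>n\<close> tend to infinity and then the time step to 0
  stays inside, and the neighbourhood shrinks to the compact image.\<close>

lemma limit_derivative_in_image:
  assumes lim: "\<eta> \<longlonglongrightarrow> 0" "a \<longlonglongrightarrow> t" "b \<longlonglongrightarrow> T"
    and approx: "\<And>n. approx_trajectory M (\<eta> n) (a n) (b n) (Y n)"
    and conv: "\<And>s. s \<in> {t..T} \<Longrightarrow> (\<lambda>n. Y n s) \<longlonglongrightarrow> y s"
    and s: "0 \<le> t" "t < s" "s < T" and D: "(y has_vector_derivative D) (at s)"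
  shows "D \<in> f s (y s) ` U"
proof -
  have M: "0 \<le> M" using approx[of 0] unfolding approx_trajectory_def
    by (metis abs_1 diff_zero mult.right_neutral norm_ge_zero order_trans)
  have sT: "s \<in> {0..T}" using s by auto
  have "\<exists>p\<in>f s (y s) ` U. dist p D < e" if "e > 0" for e
  proof -
    \<comment> \<open>Minkowski sum of the velocity image and a closed ball: convex because the
      image is convex, closed because it is compact.\<close>
    define K where "K = (\<Union>p\<in>f s (y s) ` U. \<Union>q\<in>cball 0 (e/2). {p + q})"
    have K: "convex K" "closed K"
      unfolding K_def
      using f_convex[OF sT] convex_sums[of "f s (y s) ` U" "cball 0 (e/2)"]
        compact_sums'[OF f_image_compact[OF sT], of "cball 0 (e/2)" "y s"]
      by (auto intro: compact_imp_closed)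
    obtain \<rho> where \<rho>: "\<rho> > 0" "\<And>\<sigma> z u. \<lbrakk>\<sigma> \<in> {0..T}; \<bar>\<sigma> - s\<bar> \<le> \<rho>; norm (z - y s) \<le> \<rho>; u \<in> U\<rbrakk> \<Longrightarrow>
        norm (f \<sigma> z u - f s (y s) u) < e/2"
      using f_uniformly_near[OF sT, of "e/2" "y s"] \<open>e > 0\<close> by (metis half_gt_zero)
    have inK: "f \<sigma> z u \<in> K" if "\<sigma> \<in> {0..T}" "\<bar>\<sigma> - s\<bar> \<le> \<rho>" "norm (z - y s) \<le> \<rho>" "u \<in> U" for \<sigma> z u
      unfolding K_def using \<rho>(2)[OF that] that(4)
      by (auto intro!: bexI[of _ u] bexI[of _ "f \<sigma> z u - f s (y s) u"])
    have quot: "(y (s + h) - y s) /\<^sub>R h \<in> K" if h: "0 < h" "s + h < T" "h \<le> \<rho> / 2" "M * h \<le> \<rho> / 2" for h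
    proof (rule Lim_in_closed_set[OF K(2)])
      \<comment> \<open>The radius \<open>\<rho>\<close> is split into \<open>\<rho> / 2\<close> for
        \<open>M * h\<close> and \<open>\<rho> / 4\<close> each for \<open>\<eta> n\<close> and for
        the distance from \<open>Y n s\<close> to \<open>y s\<close>.\<close>
      have e1: "\<forall>\<^sub>F n in sequentially. a n < s" using lim(2) s by (auto intro: order_tendstoD)
      have e2: "\<forall>\<^sub>F n in sequentially. s + h < b n" using lim(3) h by (auto intro: order_tendstoD)
      have e3: "\<forall>\<^sub>F n in sequentially. \<eta> n < \<rho> / 4" using order_tendstoD(2)[OF lim(1), of "\<rho> / 4"] \<rho>(1) by simp
      have e4: "\<forall>\<^sub>F n in sequentially. dist (Y n s) (y s) < \<rho> / 4"
        using conv[of s] s \<rho>(1) by (intro tendstoD) auto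
      show "\<forall>\<^sub>F n in sequentially. (Y n (s + h) - Y n s) /\<^sub>R h \<in> K"
        using e1 e2 e3 e4
      proof eventually_elim
        case (elim n)
        have "f \<sigma> z u \<in> K" if "\<sigma> \<in> {0..T}" "\<bar>\<sigma> - s\<bar> \<le> h + \<eta> n" "norm (z - Y n s) \<le> M * h + \<eta> n" "u \<in> U"
          for \<sigma> z u
        proof (rule inK)
          have "norm (z - y s) \<le> norm (z - Y n s) + dist (Y n s) (y s)"
            by (metis dist_norm dist_triangle)
          then show "norm (z - y s) \<le> \<rho>" using that elim h by linarith
        qed (use that elim h in linarith | use that in blast)+
        then show ?case
          using approx[of n] K(1) elim h unfolding approx_trajectory_def
          by (elim conjE allE[of _ s] allE[of _ "s + h"] allE[of _ K]) auto
      qed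
      show "(\<lambda>n. (Y n (s + h) - Y n s) /\<^sub>R h) \<longlonglongrightarrow> (y (s + h) - y s) /\<^sub>R h"
        using s h by (intro tendsto_intros conv) auto
    qed auto
    have "D \<in> K"
    proof (rule Lim_in_closed_set[OF K(2)])
      show "((\<lambda>h. (y (s + h) - y s) /\<^sub>R h) \<longlongrightarrow> D) (at_right 0)"
        using has_vector_derivative_quotient_tendsto[OF D] by (rule tendsto_mono[rotated]) (simp add: at_le)
      \<comment> \<open>Dividing by \<open>M + 1\<close> bounds \<open>h\<close> and
        \<open>M * h\<close> by \<open>\<rho> / 2\<close> at once; the other term keeps
        \<open>s + h\<close> before \<open>T\<close>.\<close>
      define \<delta> where "\<delta> = min (T - s) (\<rho> / (2 * (M + 1)))"
      have \<delta>: "\<delta> > 0" using s \<rho>(1) M unfolding \<delta>_def by simp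
      have "(y (s + h) - y s) /\<^sub>R h \<in> K" if "0 < h" "h < \<delta>" for h
      proof (rule quot)
        have "h * (2 * (M + 1)) \<le> \<rho>"
          using that M unfolding \<delta>_def by (simp add: pos_less_divide_eq)
        then have "h * M + h \<le> \<rho> / 2" by (simp add: algebra_simps)
        moreover have "0 \<le> h * M" using that M by simp
        ultimately show "h \<le> \<rho> / 2" "M * h \<le> \<rho> / 2" using that by (auto simp: mult.commute)
      qed (use that in \<open>auto simp: \<delta>_def\<close>)
      then show "\<forall>\<^sub>F h in at_right 0. (y (s + h) - y s) /\<^sub>R h \<in> K"
        using \<delta> unfolding eventually_at_right_field by auto
    qed auto
    then have "\<exists>p\<in>f s (y s) ` U. \<exists>q. norm q \<le> e/2 \<and> D = p + q" unfolding K_def by fastforce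
    then obtain p q where "p \<in> f s (y s) ` U" "norm q \<le> e/2" "D = p + q" by blast
    then show ?thesis using \<open>e > 0\<close> by (intro bexI[of _ p]) (auto simp: dist_norm)
  qed
  then have "D \<in> closure (f s (y s) ` U)" unfolding closure_approachable by blast
  then show ?thesis using f_image_compact[OF sT] by (simp add: compact_imp_closed)
qed

text \<open>Filippov's argument: at almost every \<open>s\<close> the derivative is
  \<open>f s (y s) u\<close> for some \<open>u\<close> in \<open>U\<close>, and such a
  \<open>u\<close> can be chosen measurably.\<close>

lemma trajectory_of_inclusion:
  assumes t: "0 \<le> t"
    and lip: "\<And>s r. norm (y s - y r) \<le> M * \<bar>s - r\<bar>"
    and incl: "\<And>s D. \<lbrakk>t < s; s < T; (y has_vector_derivative D) (at s)\<rbrakk> \<Longrightarrow> D \<in> f s (y s) ` U"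
  shows "\<exists>u\<in>controls U t T. is_trajectory f t T (y t) u y"
proof -
  obtain w where w: "w \<in> borel_measurable borel" "AE s in lebesgue. (y has_vector_derivative w s) (at s)"
    using Lipschitz_has_vector_derivative_ae[OF lip] by blast
  \<comment> \<open>The zeros of \<open>\<phi> s\<close> are the controls producing the derivative.
    The selection takes values in \<open>U\<close> also at times without a zero, as a control
    must.\<close>
  define \<phi> where "\<phi> s u = norm (f s (y s) u - w s)" for s u
  have ycont: "continuous_on S y" for S
  proof (rule lipschitz_on_continuous_on)
    show "\<bar>M\<bar>-lipschitz_on S y"
      by (rule lipschitz_onI) (auto simp: dist_norm intro!: order_trans[OF lip] mult_right_mono)
  qed
  obtain u where u: "u \<in> borel_measurable (lebesgue_on {t..T})"
    "\<And>s. s \<in> {t..T} \<Longrightarrow> u s \<in> U" "\<And>s. s \<in> {t..T} \<Longrightarrow> \<exists>u\<in>U. \<phi> s u = 0 \<Longrightarrow> \<phi> s (u s) = 0"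
  proof (rule measurable_zero_selection[of U \<phi> "lebesgue_on {t..T}"])
    fix u assume "u \<in> U"
    have "continuous_on {t..T} (\<lambda>s. (\<lambda>(s,x,u). f s x u) (s, y s, u))"
      by (rule continuous_on_compose2[OF f_cont])
        (use t \<open>u \<in> U\<close> in \<open>auto intro!: continuous_intros ycont\<close>)
    then have [measurable]: "(\<lambda>s. f s (y s) u) \<in> borel_measurable (lebesgue_on {t..T})"
      by (intro continuous_imp_measurable_on_sets_lebesgue) auto
    have [measurable]: "w \<in> borel_measurable (lebesgue_on {t..T})"
      using w(1) by (intro measurable_restrict_space1 measurable_completion) simp
    show "(\<lambda>s. \<phi> s u) \<in> borel_measurable (lebesgue_on {t..T})" unfolding \<phi>_def by measurable
  next
    fix s assume "s \<in> space (lebesgue_on {t..T})"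
    then have "s \<in> {0..T}" using t by auto
    then have "continuous_on U (\<lambda>u. (\<lambda>(s,x,u). f s x u) (s, y s, u))"
      by (intro continuous_on_compose2[OF f_cont]) (auto intro!: continuous_intros)
    then show "continuous_on U (\<phi> s)" unfolding \<phi>_def by (auto intro!: continuous_intros)
  qed (use U_compact U_nonempty in \<open>auto simp: \<phi>_def\<close>)
  have "AE s in lebesgue. s \<in> {t<..<T} \<longrightarrow> (y has_vector_derivative f s (y s) (u s)) (at s)"
    using w(2)
  proof (eventually_elim, intro impI)
    fix s assume d: "(y has_vector_derivative w s) (at s)" and s: "s \<in> {t<..<T}"
    then have "w s \<in> f s (y s) ` U" using incl by auto
    then have "\<exists>u\<in>U. \<phi> s u = 0" unfolding \<phi>_def by auto
    then have "\<phi> s (u s) = 0" using u(3) s by auto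
    then show "(y has_vector_derivative f s (y s) (u s)) (at s)" using d unfolding \<phi>_def by simp
  qed
  then have "is_trajectory f t T (y t) u y"
    unfolding is_trajectory_def using Lipschitz_imp_abs_continuous_on[OF lip] by blast
  moreover have "u \<in> controls U t T" unfolding controls_def using u by auto
  ultimately show ?thesis by blast
qed

text \<open>The common constant \<open>M\<close> gives equicontinuity and the convergent values at
  \<open>t\<close> give boundedness, so Arzela-Ascoli applies. The limit at \<open>T\<close> along
  the subsequence is kept for the terminal condition.\<close>

lemma approx_trajectories_limit:
  assumes t: "0 \<le> t" "t < T"
    and lim: "\<eta> \<longlonglongrightarrow> 0" "a \<longlonglongrightarrow> t" "b \<longlonglongrightarrow> T"
    and approx: "\<And>n. approx_trajectory M (\<eta> n) (a n) (b n) (Y n)"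
    and init: "(\<lambda>n. Y n t) \<longlonglongrightarrow> x"
  obtains u y k where "u \<in> controls U t T" "is_trajectory f t T x u y"
    "strict_mono (k :: nat \<Rightarrow> nat)" "(\<lambda>n. Y (k n) T) \<longlonglongrightarrow> y T"
proof -
  have lip: "norm (Y n s - Y n r) \<le> M * \<bar>s - r\<bar>" for n s r
    using approx[of n] unfolding approx_trajectory_def by blast
  have M: "0 \<le> M" using order_trans[OF norm_ge_zero lip[of 0 1 0]] by simp
  have "bounded (range (\<lambda>n. Y n t))" using init by (rule convergent_imp_bounded)
  then obtain B where B: "\<And>n. norm (Y n t) \<le> B" unfolding bounded_iff by auto
  obtain y0 k where k: "strict_mono (k :: nat \<Rightarrow> nat)" and
    unif: "\<And>e. 0 < e \<Longrightarrow> \<exists>N. \<forall>n s. n \<ge> N \<and> s \<in> {t..T} \<longrightarrow> norm (Y (k n) s - y0 s) < e"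
  proof (rule Arzela_Ascoli[of "{t..T}" Y "B + M * (T - t)"])
    fix n s assume s: "s \<in> {t..T}"
    have "norm (Y n s) \<le> norm (Y n t) + norm (Y n s - Y n t)" by (metis add.commute norm_triangle_sub)
    also have "\<dots> \<le> B + M * (T - t)"
      using B[of n] lip[of n s t] s mult_left_mono[OF _ M, of "\<bar>s - t\<bar>" "T - t"] by auto
    finally show "norm (Y n s) \<le> B + M * (T - t)" .
  next
    fix s and e :: real assume "0 < e"
    show "\<exists>d>0. \<forall>n r. r \<in> {t..T} \<and> norm (s - r) < d \<longrightarrow> norm (Y n s - Y n r) < e"
    proof (intro exI[of _ "e / (M + 1)"] conjI allI impI)
      show "0 < e / (M + 1)" using \<open>0 < e\<close> M by simp
      fix n r assume "r \<in> {t..T} \<and> norm (s - r) < e / (M + 1)"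
      then have "\<bar>s - r\<bar> \<le> e / (M + 1)" by simp
      then have "M * \<bar>s - r\<bar> \<le> M * (e / (M + 1))" using M by (rule mult_left_mono)
      also have "\<dots> < e" using \<open>0 < e\<close> M by (simp add: field_simps)
      finally show "norm (Y n s - Y n r) < e" using lip[of n s r] by linarith
    qed
  qed auto
  have conv0: "(\<lambda>n. Y (k n) s) \<longlonglongrightarrow> y0 s" if "s \<in> {t..T}" for s
    using unif that unfolding lim_sequentially dist_norm by blast
  \<comment> \<open>The limit is known on \<open>{t..T}\<close> only; composing with the 1-Lipschitz
    projection onto this interval gives a curve that is Lipschitz on the whole line.\<close>
  define c where "c s = max t (min T s)" for s
  have c: "c s \<in> {t..T}" "\<bar>c s - c r\<bar> \<le> \<bar>s - r\<bar>" for s r unfolding c_def using t by auto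
  have c_id: "c s = s" if "s \<in> {t..T}" for s using that unfolding c_def by auto
  define y where "y s = y0 (c s)" for s
  have conv: "(\<lambda>n. Y (k n) s) \<longlonglongrightarrow> y s" if "s \<in> {t..T}" for s
    using conv0[OF that] c_id[OF that] unfolding y_def by simp
  have "norm (y s - y r) \<le> M * \<bar>s - r\<bar>" for s r
  proof -
    have "norm (y0 (c s) - y0 (c r)) \<le> M * \<bar>c s - c r\<bar>"
    proof (rule LIMSEQ_le_const2)
      show "(\<lambda>n. norm (Y (k n) (c s) - Y (k n) (c r))) \<longlonglongrightarrow> norm (y0 (c s) - y0 (c r))"
        by (intro tendsto_intros conv0 c)
    qed (use lip in blast)
    also have "\<dots> \<le> M * \<bar>s - r\<bar>" using c(2) M by (rule mult_left_mono)
    finally show ?thesis unfolding y_def .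
  qed
  moreover have "D \<in> f s (y s) ` U" if "t < s" "s < T" "(y has_vector_derivative D) (at s)" for s D
    by (rule limit_derivative_in_image[where Y = "\<lambda>n. Y (k n)" and \<eta> = "\<lambda>n. \<eta> (k n)"
          and a = "\<lambda>n. a (k n)" and b = "\<lambda>n. b (k n)" and M = M and t = t])
      (use approx conv t that lim[THEN LIMSEQ_subseq_LIMSEQ, OF k] in \<open>auto simp: o_def\<close>)
  ultimately obtain u where "u \<in> controls U t T" "is_trajectory f t T (y t) u y"
    using trajectory_of_inclusion[OF t(1)] by blast
  moreover have "y t = x"
    using LIMSEQ_unique[OF conv[of t]] LIMSEQ_subseq_LIMSEQ[OF init k] t by (auto simp: o_def)
  moreover have "(\<lambda>n. Y (k n) T) \<longlonglongrightarrow> y T" using conv[of T] t by simp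
  ultimately show thesis using that k by blast
qed

end

section \<open>Decrease of the inf-convolution\<close>

context hj_supersolution
begin

text \<open>Time is regularised along with space, so the penalty yields a test function in both
  variables. Over a compact box a minimiser exists without growth conditions on
  \<open>v\<close>.\<close>

definition inf_conv :: "real \<Rightarrow> real \<Rightarrow> real \<Rightarrow> 'a \<Rightarrow> real" where
  "inf_conv \<epsilon> R t x =
     (INF p\<in>{0..T} \<times> cball 0 R. v (fst p) (snd p) + ((t - fst p)\<^sup>2 + (norm (x - snd p))\<^sup>2) / (2 * \<epsilon>))"

lemma inf_conv_attained:
  assumes "0 \<le> R"
  obtains s y where "s \<in> {0..T}" "norm y \<le> R"
    "inf_conv \<epsilon> R t x = v s y + ((t - s)\<^sup>2 + (norm (x - y))\<^sup>2) / (2 * \<epsilon>)"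
    "\<And>s' y'. \<lbrakk>s' \<in> {0..T}; norm y' \<le> R\<rbrakk> \<Longrightarrow>
        inf_conv \<epsilon> R t x \<le> v s' y' + ((t - s')\<^sup>2 + (norm (x - y'))\<^sup>2) / (2 * \<epsilon>)"
proof -
  let ?B = "{0..T} \<times> cball (0::'a) R"
  let ?F = "\<lambda>p. v (fst p) (snd p) + ((t - fst p)\<^sup>2 + (norm (x - snd p))\<^sup>2) / (2 * \<epsilon>)"
  have "continuous_on ?B (\<lambda>p. v (fst p) (snd p))"
    using continuous_on_subset[OF v_cont, of ?B] by (auto simp: case_prod_unfold)
  then have "continuous_on ?B ?F"
    unfolding divide_inverse by (intro continuous_intros)
  moreover have "compact ?B" "?B \<noteq> {}" using T_pos assms by (auto intro: compact_Times)
  ultimately obtain p where p: "p \<in> ?B" "\<And>q. q \<in> ?B \<Longrightarrow> ?F p \<le> ?F q"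
    using continuous_attains_inf[of ?B ?F] by blast
  have eq: "inf_conv \<epsilon> R t x = ?F p"
    unfolding inf_conv_def using p by (intro cInf_eq_minimum) auto
  show thesis
  proof (rule that[of "fst p" "snd p"])
    fix s' :: real and y' :: 'a assume "s' \<in> {0..T}" "norm y' \<le> R"
    then show "inf_conv \<epsilon> R t x \<le> v s' y' + ((t - s')\<^sup>2 + (norm (x - y'))\<^sup>2) / (2 * \<epsilon>)"
      unfolding eq using p(2)[of "(s', y')"] by simp
  qed (use p eq in auto)
qed

lemma inf_conv_le:
  assumes "s \<in> {0..T}" "norm y \<le> R"
  shows "inf_conv \<epsilon> R t x \<le> v s y + ((t - s)\<^sup>2 + (norm (x - y))\<^sup>2) / (2 * \<epsilon>)"
proof -
  have "0 \<le> R" using assms(2) norm_ge_zero order_trans by blast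
  then show ?thesis using inf_conv_attained[of R \<epsilon> t x] assms by metis
qed

lemma hamiltonian_attained:
  assumes "s \<in> {0..T}"
  obtains u where "u \<in> U" "hamiltonian f U s x p = (- p) \<bullet> f s x u"
proof -
  have "continuous_on U (\<lambda>u. (\<lambda>(s,x,u). f s x u) (s, x, u))"
    by (rule continuous_on_compose2[OF f_cont]) (use assms in \<open>auto intro!: continuous_intros\<close>)
  then have "continuous_on U (\<lambda>u. (- p) \<bullet> f s x u)" by (auto intro!: continuous_intros)
  then obtain u where u: "u \<in> U" "\<And>w. w \<in> U \<Longrightarrow> (- p) \<bullet> f s x w \<le> (- p) \<bullet> f s x u"
    using continuous_attains_sup[OF U_compact U_nonempty] by blast
  have "hamiltonian f U s x p = (- p) \<bullet> f s x u"
    unfolding hamiltonian_def using u by (intro cSup_eq_maximum) auto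
  then show thesis using u(1) that by blast
qed

text \<open>The negated penalty is the test function: subtracting it from \<open>v\<close> gives the
  function minimised in \<open>inf_conv\<close>.\<close>

lemma C1_quadratic:
  fixes x :: 'a
  assumes "\<epsilon> \<noteq> 0"
  shows "C1_with_derivs \<Omega> (\<lambda>s y. - (((t - s)\<^sup>2 + (norm (x - y))\<^sup>2) / (2 * \<epsilon>)))
    (\<lambda>p. (t - fst p) / \<epsilon>) (\<lambda>p. (x - snd p) /\<^sub>R \<epsilon>)"
  unfolding C1_with_derivs_def
proof (intro conjI)
  show "continuous_on \<Omega> (\<lambda>p. (t - fst p) / \<epsilon>)"
    unfolding divide_inverse by (intro continuous_intros)
  show "continuous_on \<Omega> (\<lambda>p. (x - snd p) /\<^sub>R \<epsilon>)" by (intro continuous_intros)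
  have "((\<lambda>p. - (((t - fst p)\<^sup>2 + (x - snd p) \<bullet> (x - snd p)) * inverse (2 * \<epsilon>))) has_derivative
      (\<lambda>q. (t - fst p) / \<epsilon> * fst q + ((x - snd p) /\<^sub>R \<epsilon>) \<bullet> snd q)) (at p)" for p :: "real \<times> 'a"
    by (rule derivative_eq_intros refl)+
      (use assms in \<open>simp add: fun_eq_iff inner_commute inner_diff_left inner_diff_right field_simps power2_eq_square\<close>)
  then show "\<forall>(s, y)\<in>\<Omega>. ((\<lambda>(s, y). - (((t - s)\<^sup>2 + (norm (x - y))\<^sup>2) / (2 * \<epsilon>))) has_derivative
      (\<lambda>(h, k). (t - fst (s, y)) / \<epsilon> * h + ((x - snd (s, y)) /\<^sub>R \<epsilon>) \<bullet> k)) (at (s, y))"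
    unfolding power2_norm_eq_inner divide_inverse[of _ "2 * \<epsilon>"] case_prod_unfold by auto
qed

text \<open>The bound on \<open>4 * \<epsilon> * C\<close> keeps the minimiser within
  \<open>\<rho>\<close> of \<open>(t, x)\<close>, hence in the interior of the box. The same
  minimiser serves as competitor at the shifted point.\<close>

lemma inf_conv_step:
  assumes \<epsilon>: "\<epsilon> > 0" and \<rho>: "\<rho> > 0" "4 * \<epsilon> * C < \<rho>\<^sup>2"
    and C: "\<And>s y. \<lbrakk>s \<in> {0..T}; norm y \<le> R\<rbrakk> \<Longrightarrow> \<bar>v s y\<bar> \<le> C"
    and t: "\<rho> \<le> t" "t \<le> T - \<rho>" and x: "norm x + \<rho> \<le> R"
    and neg: "inf_conv \<epsilon> R t x < 0"
  obtains s y u where "s \<in> {0..T}" "\<bar>s - t\<bar> < \<rho>" "norm (y - x) < \<rho>" "u \<in> U" "v s y < 0"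
    "\<And>h. 0 \<le> h \<Longrightarrow> inf_conv \<epsilon> R (t + h) (x + h *\<^sub>R f s y u) \<le>
       inf_conv \<epsilon> R t x + h\<^sup>2 * (1 + (norm (f s y u))\<^sup>2) / (2 * \<epsilon>)"
proof -
  have R0: "0 \<le> R" using x \<rho>(1) norm_ge_zero[of x] by linarith
  obtain s y where sy: "s \<in> {0..T}" "norm y \<le> R"
    and eq: "inf_conv \<epsilon> R t x = v s y + ((t - s)\<^sup>2 + (norm (x - y))\<^sup>2) / (2 * \<epsilon>)"
    and le: "\<And>s' y'. \<lbrakk>s' \<in> {0..T}; norm y' \<le> R\<rbrakk> \<Longrightarrow>
        inf_conv \<epsilon> R t x \<le> v s' y' + ((t - s')\<^sup>2 + (norm (x - y'))\<^sup>2) / (2 * \<epsilon>)"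
    using inf_conv_attained[OF R0, of \<epsilon> t x] by metis
  have tT: "t \<in> {0..T}" "norm x \<le> R" using t x \<rho>(1) by auto
  \<comment> \<open>The competitor \<open>(t, x)\<close> has penalty 0, so the penalty at the
    minimiser is at most a difference of two values of \<open>v\<close>.\<close>
  have "((t - s)\<^sup>2 + (norm (x - y))\<^sup>2) / (2 * \<epsilon>) \<le> v t x - v s y"
    using le[OF tT] unfolding eq by simp
  also have "\<dots> \<le> 2 * C" using C[OF tT] C[OF sy] by linarith
  finally have "(t - s)\<^sup>2 + (norm (x - y))\<^sup>2 \<le> 4 * \<epsilon> * C" using \<epsilon> by (simp add: field_simps)
  then have "(t - s)\<^sup>2 < \<rho>\<^sup>2" "(norm (x - y))\<^sup>2 < \<rho>\<^sup>2"
    using \<rho>(2) zero_le_power2[of "t - s"] zero_le_power2[of "norm (x - y)"] by linarith+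
  then have "\<bar>t - s\<bar> < \<rho>" "norm (x - y) < \<rho>"
    using \<rho>(1) power2_less_imp_less[of "\<bar>t - s\<bar>" \<rho>] power2_less_imp_less[of "norm (x - y)" \<rho>]
    by (auto simp only: power2_abs)
  then have near: "\<bar>s - t\<bar> < \<rho>" "norm (y - x) < \<rho>"
    by (simp_all add: norm_minus_commute abs_minus_commute)
  have s_in: "0 < s" "s < T" using near(1) t by auto
  have "norm y \<le> norm x + norm (y - x)" by (metis norm_triangle_sub)
  then have y_in: "norm y < R" using near(2) x by linarith
  \<comment> \<open>As the penalty is nonnegative, \<open>v s y\<close> is at most the negative
    value of \<open>inf_conv\<close>, so the minimiser lies where the supersolution inequality
    holds.\<close>
  have "0 \<le> ((t - s)\<^sup>2 + (norm (x - y))\<^sup>2) / (2 * \<epsilon>)" using \<epsilon> by simp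
  then have vneg: "v s y < 0" using neg eq by linarith
  let ?\<Omega> = "{(t,x). t \<in> {0<..<T} \<and> v t x < 0}"
  txt \<open>A minimiser in the inf-convolution is a point where a quadratic touches \<open>v\<close> from below; the
    supersolution inequality there yields a velocity along which the penalty does not grow to first order.\<close>
  let ?\<xi> = "\<lambda>s' y'. - (((t - s')\<^sup>2 + (norm (x - y'))\<^sup>2) / (2 * \<epsilon>))"
  \<comment> \<open>The radius \<open>R - norm y\<close> keeps competitors in
    \<open>cball 0 R\<close>, where minimality is known.\<close>
  have "\<forall>(s', y')\<in>ball (s, y) (R - norm y) \<inter> ?\<Omega>. v s y - ?\<xi> s y \<le> v s' y' - ?\<xi> s' y'"
  proof clarify
    fix s' y' assume *: "(s', y') \<in> ball (s, y) (R - norm y)" and s': "s' \<in> {0<..<T}"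
    have "dist y y' \<le> dist (s, y) (s', y')" by (metis dist_snd_le snd_conv)
    then have "norm (y' - y) < R - norm y" using * by (simp add: dist_norm norm_minus_commute)
    then have "norm y' \<le> R" using norm_triangle_sub[of y' y] by linarith
    then show "v s y - ?\<xi> s y \<le> v s' y' - ?\<xi> s' y'" using le[of s' y'] s' unfolding eq by simp
  qed
  then have "\<exists>e>0. \<forall>(s', y')\<in>ball (s, y) e \<inter> ?\<Omega>. v s y - ?\<xi> s y \<le> v s' y' - ?\<xi> s' y'"
    using y_in by (intro exI[of _ "R - norm y"]) simp
  moreover have "C1_with_derivs ?\<Omega> ?\<xi> (\<lambda>p. (t - fst p) / \<epsilon>) (\<lambda>p. (x - snd p) /\<^sub>R \<epsilon>)"
    using \<epsilon> by (intro C1_quadratic) simp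
  moreover have "(s, y) \<in> ?\<Omega>" using s_in vneg by simp
  ultimately have visc: "- ((t - s) / \<epsilon>) + hamiltonian f U s y ((x - y) /\<^sub>R \<epsilon>) \<ge> 0"
    using v_super[unfolded viscosity_supersolution_def, rule_format, of ?\<xi> "\<lambda>p. (t - fst p) / \<epsilon>" "\<lambda>p. (x - snd p) /\<^sub>R \<epsilon>" s y]
    by simp
  obtain u where u: "u \<in> U" "hamiltonian f U s y ((x - y) /\<^sub>R \<epsilon>) = (- ((x - y) /\<^sub>R \<epsilon>)) \<bullet> f s y u"
    using hamiltonian_attained[OF sy(1)] by blast
  define w where "w = f s y u"
  have "(t - s) / \<epsilon> + ((x - y) \<bullet> w) / \<epsilon> \<le> 0"
    using visc unfolding u(2) w_def[symmetric] by (simp add: divide_inverse mult.commute)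
  then have decr: "(t - s) + (x - y) \<bullet> w \<le> 0"
    using \<epsilon> by (simp add: add_divide_distrib[symmetric] divide_le_0_iff)
  have "inf_conv \<epsilon> R (t + h) (x + h *\<^sub>R w) \<le> inf_conv \<epsilon> R t x + h\<^sup>2 * (1 + (norm w)\<^sup>2) / (2 * \<epsilon>)"
    if "0 \<le> h" for h
  proof -
    \<comment> \<open>The part linear in \<open>h\<close> is made nonpositive by
      \<open>decr\<close>; only the quadratic part can raise the penalty.\<close>
    have "(t + h - s)\<^sup>2 + (norm (x + h *\<^sub>R w - y))\<^sup>2 =
        (t - s)\<^sup>2 + (norm (x - y))\<^sup>2 + 2 * (h * ((t - s) + (x - y) \<bullet> w)) + h\<^sup>2 * (1 + (norm w)\<^sup>2)"
      unfolding power2_norm_eq_inner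
      by (simp add: algebra_simps inner_add_left inner_add_right inner_diff_left inner_diff_right
          inner_commute power2_eq_square)
    also have "\<dots> \<le> (t - s)\<^sup>2 + (norm (x - y))\<^sup>2 + h\<^sup>2 * (1 + (norm w)\<^sup>2)"
      using decr that by (simp add: mult_nonneg_nonpos)
    finally have "((t + h - s)\<^sup>2 + (norm (x + h *\<^sub>R w - y))\<^sup>2) / (2 * \<epsilon>) \<le>
        ((t - s)\<^sup>2 + (norm (x - y))\<^sup>2 + h\<^sup>2 * (1 + (norm w)\<^sup>2)) / (2 * \<epsilon>)"
      using \<epsilon> by (intro divide_right_mono) auto
    then show ?thesis
      using inf_conv_le[OF sy, of \<epsilon> "t + h" "x + h *\<^sub>R w"] unfolding eq add_divide_distrib by linarith
  qed
  then show thesis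
    using that[of s y u] sy near u(1) vneg unfolding w_def by blast
qed

end

section \<open>Euler polygons\<close>

text \<open>The weight of \<open>w k\<close> is the time spent in the \<open>k\<close>-th mesh cell
  up to time \<open>s\<close>. The formula covers the whole line, is constant outside the mesh, and
  turns increments into sums over cells.\<close>

definition polygon :: "real \<Rightarrow> real \<Rightarrow> nat \<Rightarrow> (nat \<Rightarrow> 'a) \<Rightarrow> 'a \<Rightarrow> real \<Rightarrow> 'a::real_vector" where
  "polygon a h N w x s = x + (\<Sum>k<N. max 0 (min h (s - a - real k * h)) *\<^sub>R w k)"

lemma sum_clamp:
  fixes h z :: real
  assumes "0 \<le> h"
  shows "(\<Sum>k<N. max 0 (min h (z - real k * h))) = max 0 (min (real N * h) z)"
proof (induction N)
  case (Suc N)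
  have "0 \<le> real N * h" using assms by simp
  then have "max 0 (min (real N * h) z) + max 0 (min h (z - real N * h)) = max 0 (min (real N * h + h) z)"
    using assms by linarith
  then show ?case using Suc by (simp add: algebra_simps)
qed simp

lemma polygon_diff:
  "polygon a h N w x r - polygon a h N w x s =
    (\<Sum>k<N. (max 0 (min h (r - a - real k * h)) - max 0 (min h (s - a - real k * h))) *\<^sub>R w k)"
  unfolding polygon_def by (simp add: sum_subtractf scaleR_diff_left)

text \<open>Cell weights grow with time, and by \<open>sum_clamp\<close> their total growth is at
  most the elapsed time.\<close>

lemma polygon_Lipschitz:
  fixes w :: "nat \<Rightarrow> 'a::real_normed_vector"
  assumes "0 \<le> h" "0 \<le> M" and w: "\<And>k. k < N \<Longrightarrow> norm (w k) \<le> M"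
  shows "norm (polygon a h N w x r - polygon a h N w x s) \<le> M * \<bar>r - s\<bar>"
proof -
  have *: "norm (polygon a h N w x r - polygon a h N w x s) \<le> M * (r - s)" if "s \<le> r" for r s
  proof -
    let ?c = "\<lambda>s k. max 0 (min h (s - a - real k * h))"
    have "norm (polygon a h N w x r - polygon a h N w x s) \<le> (\<Sum>k<N. norm ((?c r k - ?c s k) *\<^sub>R w k))"
      unfolding polygon_diff by (rule norm_sum)
    also have "\<dots> \<le> (\<Sum>k<N. (?c r k - ?c s k) * M)"
    proof (rule sum_mono)
      fix k assume "k \<in> {..<N}"
      moreover have "0 \<le> ?c r k - ?c s k" using that by linarith
      ultimately show "norm ((?c r k - ?c s k) *\<^sub>R w k) \<le> (?c r k - ?c s k) * M"
        using w by (simp add: mult_left_mono)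
    qed
    also have "\<dots> = (max 0 (min (real N * h) (r - a)) - max 0 (min (real N * h) (s - a))) * M"
      unfolding sum_distrib_right[symmetric] sum_subtractf sum_clamp[OF assms(1)] ..
    also have "\<dots> \<le> (r - s) * M"
      using that assms(2) by (intro mult_right_mono) linarith+
    finally show ?thesis by (simp add: mult.commute)
  qed
  show ?thesis using *[of s r] *[of r s] by (cases "s \<le> r") (auto simp: norm_minus_commute)
qed

lemma polygon_before:
  assumes "s \<le> a" "0 \<le> h"
  shows "polygon a h N w x s = x"
proof -
  have "max 0 (min h (s - a - real k * h)) = 0" for k
  proof -
    have "0 \<le> real k * h" using assms by simp
    then show ?thesis using assms by linarith
  qed
  then show ?thesis unfolding polygon_def by simp
qed

text \<open>At a node the cells already passed have full weight \<open>h\<close> and the others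
  weight 0.\<close>

lemma polygon_node:
  fixes X :: "nat \<Rightarrow> 'a::real_vector"
  assumes "0 \<le> h" "j \<le> N" and X: "X 0 = x" "\<And>k. k < N \<Longrightarrow> X (Suc k) = X k + h *\<^sub>R w k"
  shows "polygon a h N w x (a + real j * h) = X j"
proof -
  have Xj: "X j = x + (\<Sum>k<j. h *\<^sub>R w k)" if "j \<le> N" for j
    using that by (induction j) (auto simp: X)
  have c: "max 0 (min h (a + real j * h - a - real k * h)) = (if k < j then h else 0)" for k
  proof (cases "k < j")
    case True
    then have "real (Suc k) * h \<le> real j * h" using assms(1) by (intro mult_right_mono) auto
    then show ?thesis using True assms(1) by (simp add: algebra_simps)
  next
    case False
    then have "real j * h \<le> real k * h" using assms(1) by (intro mult_right_mono) auto
    then show ?thesis using False assms(1) by simp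
  qed
  have "(\<Sum>k<N. (if k < j then h else 0) *\<^sub>R w k) = (\<Sum>k<j. h *\<^sub>R w k)"
    by (rule sum.mono_neutral_cong_right) (use assms(2) in auto)
  then show ?thesis unfolding polygon_def c using Xj[OF assms(2)] by simp
qed

text \<open>The quotient is a convex combination of cell velocities, weighted by the fraction of
  \<open>{s..r}\<close> spent in each cell.\<close>

lemma polygon_average:
  fixes w :: "nat \<Rightarrow> 'a::real_vector"
  assumes h: "0 < h" and sr: "a \<le> s" "s < r" "r \<le> a + real N * h" and K: "convex K"
    and w: "\<And>k. \<lbrakk>k < N; a + real k * h < r; s < a + real k * h + h\<rbrakk> \<Longrightarrow> w k \<in> K"
  shows "(polygon a h N w x r - polygon a h N w x s) /\<^sub>R (r - s) \<in> K"
proof -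
  define c where "c k = max 0 (min h (r - a - real k * h)) - max 0 (min h (s - a - real k * h))" for k
  \<comment> \<open>Only cells met for a positive time are kept, as only their velocities are known
    to lie in \<open>K\<close>.\<close>
  define I where "I = {k. k < N \<and> 0 < c k}"
  have c0: "0 \<le> c k" for k unfolding c_def using sr by linarith
  have "sum c I = sum c {..<N}"
    unfolding I_def by (rule sum.mono_neutral_left) (use c0 in \<open>auto simp: not_less intro: antisym\<close>)
  also have "\<dots> = r - s"
    unfolding c_def sum_subtractf sum_clamp[OF less_imp_le[OF h]] using sr by linarith
  finally have sum: "sum c I = r - s" .
  have "(\<Sum>k\<in>I. (c k / (r - s)) *\<^sub>R w k) \<in> K"
  proof (rule convex_sum[OF _ K])
    show "(\<Sum>k\<in>I. c k / (r - s)) = 1" unfolding sum_divide_distrib[symmetric] sum using sr by simp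
    fix k assume "k \<in> I"
    then have k: "k < N" "0 < c k" unfolding I_def by auto
    show "0 \<le> c k / (r - s)" using k sr by simp
    have "a + real k * h < r" "s < a + real k * h + h" using k(2) sr h unfolding c_def by linarith+
    then show "w k \<in> K" using w k by blast
  qed (simp add: I_def)
  also have "(\<Sum>k\<in>I. (c k / (r - s)) *\<^sub>R w k) = (\<Sum>k\<in>I. c k *\<^sub>R w k) /\<^sub>R (r - s)"
    by (simp add: scaleR_sum_right divide_inverse mult.commute)
  also have "(\<Sum>k\<in>I. c k *\<^sub>R w k) = (\<Sum>k<N. c k *\<^sub>R w k)"
    unfolding I_def by (rule sum.mono_neutral_left) (use c0 in \<open>auto simp: not_less intro: antisym\<close>)
  finally show ?thesis unfolding polygon_diff c_def .
qed

section \<open>Growth bounds and polygons that keep the inf-convolution negative\<close>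

context hj_supersolution
begin

lemma f_linear_growth:
  obtains A where "0 \<le> A" "\<And>s x u. \<lbrakk>s \<in> {0..T}; u \<in> U\<rbrakk> \<Longrightarrow> norm (f s x u) \<le> A + L * norm x"
proof -
  have "compact ((\<lambda>(s,x,u). f s x u) ` ({0..T} \<times> {0} \<times> U))"
    by (intro compact_continuous_image continuous_on_subset[OF f_cont] compact_Times U_compact) auto
  then have "bounded ((\<lambda>(s,x,u). f s x u) ` ({0..T} \<times> {0} \<times> U))" by (rule compact_imp_bounded)
  then obtain A where A: "\<And>s u. \<lbrakk>s \<in> {0..T}; u \<in> U\<rbrakk> \<Longrightarrow> norm (f s 0 u) \<le> A"
    unfolding bounded_iff by force
  show thesis
  proof (rule that[of "\<bar>A\<bar>"])
    fix s x u assume *: "s \<in> {0..T}" "u \<in> U"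
    have "norm (f s x u) \<le> norm (f s 0 u) + norm (f s x u - f s 0 u)" by (metis norm_triangle_sub)
    then show "norm (f s x u) \<le> \<bar>A\<bar> + L * norm x" using A[OF *] f_lip[OF *, of x 0] by simp
  qed simp
qed

lemma v_bounded_on_box:
  obtains C where "0 \<le> C" "\<And>s y. \<lbrakk>s \<in> {0..T}; norm y \<le> R\<rbrakk> \<Longrightarrow> \<bar>v s y\<bar> \<le> C"
proof -
  have "compact ((\<lambda>(t,x). v t x) ` ({0..T} \<times> cball 0 R))"
    by (intro compact_continuous_image continuous_on_subset[OF v_cont] compact_Times) auto
  then have "bounded ((\<lambda>(t,x). v t x) ` ({0..T} \<times> cball 0 R))" by (rule compact_imp_bounded)
  then obtain C where C: "\<And>s y. \<lbrakk>s \<in> {0..T}; norm y \<le> R\<rbrakk> \<Longrightarrow> \<bar>v s y\<bar> \<le> C"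
    unfolding bounded_iff by force
  show thesis by (rule that[of "\<bar>C\<bar>"]) (use C in force)+
qed

text \<open>Iteration of \<open>inf_conv_step\<close>: \<open>R0\<close> is the Gronwall bound for
  the nodes, \<open>M\<close> the resulting bound for the velocities, and \<open>small\<close> says
  that the rises of all \<open>N\<close> steps together leave \<open>inf_conv\<close> negative. The
  range \<open>k \<le> N\<close> includes the final node, so that it too has a nearby point with
  \<open>v\<close> negative.\<close>

lemma euler_chain:
  fixes A C r0 R0 M :: real and x :: 'a
  assumes A: "0 \<le> A" "\<And>s x u. \<lbrakk>s \<in> {0..T}; u \<in> U\<rbrakk> \<Longrightarrow> norm (f s x u) \<le> A + L * norm x"
    and C: "\<And>s y. \<lbrakk>s \<in> {0..T}; norm y \<le> R0 + 1\<rbrakk> \<Longrightarrow> \<bar>v s y\<bar> \<le> C"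
    and R0: "R0 = exp (L * T) * (r0 + (A + L) / L)" and M: "M = L * R0"
    and \<epsilon>: "\<epsilon> > 0" and \<rho>: "0 < \<rho>" "\<rho> \<le> 1" "4 * \<epsilon> * C < \<rho>\<^sup>2" "\<rho> \<le> a" "b \<le> T - \<rho>"
    and h: "0 < h" "b = a + real N * h"
    and x: "norm x \<le> r0"
    and small: "v a x + (b - a) * h * (1 + M\<^sup>2) / (2 * \<epsilon>) < 0"
  obtains X w where "X 0 = x" "\<And>k. X (Suc k) = X k + h *\<^sub>R w k"
    "\<And>k. k \<le> N \<Longrightarrow> norm (w k) \<le> M \<and> (\<exists>s y u. s \<in> {0..T} \<and> \<bar>s - (a + real k * h)\<bar> < \<rho> \<and>
        norm (y - X k) < \<rho> \<and> u \<in> U \<and> v s y < 0 \<and> w k = f s y u)"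
proof -
  define R where "R = R0 + 1"
  \<comment> \<open>The shift absorbs the constant term:
    \<open>A + L * (norm z + 1) = L * (norm z + B)\<close>. The extra 1 allows for evaluating
    \<open>f\<close> within \<open>\<rho> \<le> 1\<close> of the node.\<close>
  define B where "B = (A + L) / L"
  have L: "0 < L" using L_ge_1 by simp
  have B: "0 \<le> B" "L * B = A + L" unfolding B_def using L A(1) by auto
  have r0: "0 \<le> r0" using x norm_ge_zero order_trans by blast
  have "1 \<le> exp (L * T)" using L T_pos by simp
  then have r0R0: "r0 + B \<le> R0"
    unfolding R0 B_def[symmetric] using r0 B mult_right_mono[of 1 "exp (L * T)" "r0 + B"] by simp
  have M0: "0 \<le> M" unfolding M using L r0R0 r0 B by simp
  define good where "good t z \<longleftrightarrow> \<rho> \<le> t \<and> t \<le> T - \<rho> \<and> norm z + \<rho> \<le> R \<and> inf_conv \<epsilon> R t z < 0" for t z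
  define P where "P t z w \<longleftrightarrow> (\<exists>s y u. s \<in> {0..T} \<and> \<bar>s - t\<bar> < \<rho> \<and> norm (y - z) < \<rho> \<and> u \<in> U \<and> v s y < 0 \<and>
    w = f s y u) \<and>
    inf_conv \<epsilon> R (t + h) (z + h *\<^sub>R w) \<le> inf_conv \<epsilon> R t z + h\<^sup>2 * (1 + (norm w)\<^sup>2) / (2 * \<epsilon>)" for t z w
  have "\<exists>w. P t z w" if g: "good t z" for t z
  proof -
    obtain s y u where "s \<in> {0..T}" "\<bar>s - t\<bar> < \<rho>" "norm (y - z) < \<rho>" "u \<in> U" "v s y < 0"
      "\<And>h. 0 \<le> h \<Longrightarrow> inf_conv \<epsilon> R (t + h) (z + h *\<^sub>R f s y u) \<le>
         inf_conv \<epsilon> R t z + h\<^sup>2 * (1 + (norm (f s y u))\<^sup>2) / (2 * \<epsilon>)"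
      by (rule inf_conv_step[of \<epsilon> \<rho> C R t z]) (use \<epsilon> \<rho> C g in \<open>auto simp: good_def R_def\<close>)
    then show ?thesis unfolding P_def using h(1) less_imp_le by blast
  qed
  \<comment> \<open>A velocity is fixed for every admissible pair, so the nodes can be defined by
    plain recursion before they are shown to be admissible.\<close>
  then obtain W where W: "\<And>t z. good t z \<Longrightarrow> P t z (W t z)" by metis
  define X where "X = rec_nat x (\<lambda>k z. z + h *\<^sub>R W (a + real k * h) z)"
  have X: "X 0 = x" "X (Suc k) = X k + h *\<^sub>R W (a + real k * h) (X k)" for k
    unfolding X_def by simp_all
  define w where "w k = W (a + real k * h) (X k)" for k
  have tk: "a \<le> a + real k * h" "a + real k * h \<le> b" if "k \<le> N" for k
    using that h by (auto intro: mult_right_mono)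
  define \<kappa> where "\<kappa> = h\<^sup>2 * (1 + M\<^sup>2) / (2 * \<epsilon>)"
  have \<kappa>: "0 \<le> \<kappa>" "real N * \<kappa> = (b - a) * h * (1 + M\<^sup>2) / (2 * \<epsilon>)"
    unfolding \<kappa>_def using \<epsilon> h(2) by (auto simp: power2_eq_square)
  \<comment> \<open>The first clause is a discrete Gronwall bound, the second counts a rise of at
    most \<open>\<kappa>\<close> per step; together they make the node admissible.\<close>
  define inv where "inv k \<longleftrightarrow> norm (X k) + B \<le> exp (L * (real k * h)) * (r0 + B) \<and>
      inf_conv \<epsilon> R (a + real k * h) (X k) \<le> v a x + real k * \<kappa>" for k
  have inv_bound: "norm (X k) + B \<le> R0" if "inv k" "k \<le> N" for k
  proof -
    have "real k * h \<le> T" using tk(2)[OF that(2)] \<rho> by linarith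
    then have "exp (L * (real k * h)) \<le> exp (L * T)" using L by simp
    then have "exp (L * (real k * h)) * (r0 + B) \<le> R0"
      unfolding R0 B_def[symmetric] using r0 B(1) by (intro mult_right_mono) auto
    then show ?thesis using that(1) unfolding inv_def by linarith
  qed
  have inv_good: "good (a + real k * h) (X k)" if "inv k" "k \<le> N" for k
    unfolding good_def
  proof (intro conjI)
    show "\<rho> \<le> a + real k * h" "a + real k * h \<le> T - \<rho>" using tk[OF that(2)] \<rho> by linarith+
    show "norm (X k) + \<rho> \<le> R" using inv_bound[OF that] B(1) \<rho>(2) unfolding R_def by linarith
    have "real k * \<kappa> \<le> real N * \<kappa>" using that(2) \<kappa>(1) by (intro mult_right_mono) auto
    then show "inf_conv \<epsilon> R (a + real k * h) (X k) < 0"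
      using that(1) small unfolding inv_def \<kappa>(2) by linarith
  qed
  have w_bound: "norm (w k) \<le> L * (norm (X k) + B)" if k: "inv k" "k \<le> N" for k
  proof -
    obtain s y u where su: "s \<in> {0..T}" "u \<in> U" and y: "norm (y - X k) < \<rho>" "w k = f s y u"
      using W[OF inv_good[OF k]] unfolding P_def w_def by blast
    have "norm y \<le> norm (X k) + norm (y - X k)" by (metis norm_triangle_sub)
    then have "norm y \<le> norm (X k) + 1" using y(1) \<rho>(2) by linarith
    then have "L * norm y \<le> L * (norm (X k) + 1)" using L by (intro mult_left_mono) auto
    then show ?thesis using A(2)[OF su, of y] B(2) unfolding y(2) by (simp add: distrib_left)
  qed
  have w_M: "norm (w k) \<le> M" if k: "inv k" "k \<le> N" for k
    using w_bound[OF k] mult_left_mono[OF inv_bound[OF k], of L] L unfolding M by linarith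
  have inv: "inv k" if "k \<le> N" for k
    using that
  proof (induction k)
    case 0
    have "a \<le> b" using tk[of N] by linarith
    then have "a \<in> {0..T}" "norm x \<le> R" using \<rho> x r0R0 B(1) unfolding R_def by auto
    \<comment> \<open>The competitor \<open>(a, x)\<close> has penalty 0.\<close>
    then have "inf_conv \<epsilon> R a x \<le> v a x" using inf_conv_le[of a x R \<epsilon> a x] by simp
    then show ?case using x unfolding inv_def X by simp
  next
    case (Suc k)
    then have k: "inv k" "k \<le> N" by auto
    have "norm (X (Suc k)) \<le> norm (X k) + h * norm (w k)"
      unfolding X(2) w_def using norm_triangle_ineq[of "X k" "h *\<^sub>R W (a + real k * h) (X k)"] h(1) by simp
    also have "h * norm (w k) \<le> h * (L * (norm (X k) + B))"
      using w_bound[OF k] h(1) by (intro mult_left_mono) auto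
    finally have "norm (X (Suc k)) + B \<le> (1 + L * h) * (norm (X k) + B)"
      by (simp add: algebra_simps)
    also have "\<dots> \<le> exp (L * h) * (exp (L * (real k * h)) * (r0 + B))"
      using k(1) B(1) unfolding inv_def by (intro mult_mono exp_ge_add_one_self) auto
    also have "\<dots> = exp (L * (real (Suc k) * h)) * (r0 + B)"
      by (simp add: algebra_simps flip: exp_add)
    finally have 1: "norm (X (Suc k)) + B \<le> exp (L * (real (Suc k) * h)) * (r0 + B)" .
    have "(norm (w k))\<^sup>2 \<le> M\<^sup>2" using w_M[OF k] by (intro power_mono) auto
    then have "h\<^sup>2 * (1 + (norm (w k))\<^sup>2) / (2 * \<epsilon>) \<le> \<kappa>"
      unfolding \<kappa>_def using \<epsilon> by (intro divide_right_mono mult_left_mono) auto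
    moreover have "inf_conv \<epsilon> R (a + real k * h + h) (X (Suc k)) \<le>
        inf_conv \<epsilon> R (a + real k * h) (X k) + h\<^sup>2 * (1 + (norm (w k))\<^sup>2) / (2 * \<epsilon>)"
      using W[OF inv_good[OF k]] unfolding P_def X(2) w_def by blast
    ultimately have "inf_conv \<epsilon> R (a + real k * h + h) (X (Suc k)) \<le> v a x + real k * \<kappa> + \<kappa>"
      using k(1) unfolding inv_def by linarith
    then have "inf_conv \<epsilon> R (a + real (Suc k) * h) (X (Suc k)) \<le> v a x + real (Suc k) * \<kappa>"
      by (simp add: algebra_simps)
    with 1 show ?case unfolding inv_def by blast
  qed
  show thesis
  proof (rule that[of X w])
    show "X 0 = x" by (rule X)
    show "X (Suc k) = X k + h *\<^sub>R w k" for k unfolding w_def by (rule X)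
    fix k assume "k \<le> N"
    then show "norm (w k) \<le> M \<and> (\<exists>s y u. s \<in> {0..T} \<and> \<bar>s - (a + real k * h)\<bar> < \<rho> \<and>
        norm (y - X k) < \<rho> \<and> u \<in> U \<and> v s y < 0 \<and> w k = f s y u)"
      using w_M inv W[OF inv_good] unfolding P_def w_def by blast
  qed
qed

text \<open>\<open>M\<close> is chosen before \<open>\<eta>\<close>, \<open>a\<close>,
  \<open>b\<close> and the starting point, so a sequence of polygons can share one Lipschitz
  constant. The parameters are fixed in the order \<open>\<rho>\<close>, \<open>\<epsilon>\<close>,
  \<open>h\<close>.\<close>

lemma approx_trajectory_exists:
  obtains M where "\<And>\<eta> a b x. \<lbrakk>0 < \<eta>; 0 < a; a < b; b < T; norm x \<le> r0; v a x < 0\<rbrakk> \<Longrightarrow>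
    \<exists>Y t z. approx_trajectory M \<eta> a b Y \<and> (\<forall>s\<le>a. Y s = x) \<and>
      t \<in> {0..T} \<and> \<bar>t - b\<bar> \<le> \<eta> \<and> norm (z - Y b) \<le> \<eta> \<and> v t z < 0"
proof -
  obtain A where A: "0 \<le> A" "\<And>s x u. \<lbrakk>s \<in> {0..T}; u \<in> U\<rbrakk> \<Longrightarrow> norm (f s x u) \<le> A + L * norm x"
    using f_linear_growth by metis
  define R0 where "R0 = exp (L * T) * (r0 + (A + L) / L)"
  define M where "M = L * R0"
  obtain C where C: "0 \<le> C" "\<And>s y. \<lbrakk>s \<in> {0..T}; norm y \<le> R0 + 1\<rbrakk> \<Longrightarrow> \<bar>v s y\<bar> \<le> C"
    using v_bounded_on_box by metis
  show thesis
  proof (rule that[of M])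
    fix \<eta> a b :: real and x :: 'a
    assume \<eta>: "0 < \<eta>" and ab: "0 < a" "a < b" "b < T" and x: "norm x \<le> r0" and neg: "v a x < 0"
    have "0 \<le> r0" using x norm_ge_zero order_trans by blast
    then have M0: "0 \<le> M" unfolding M_def R0_def using A(1) L_ge_1 by simp
    \<comment> \<open>The terms \<open>a\<close> and \<open>T - b\<close> keep sampled times inside
      the open interval, 1 serves the Gronwall bound, and \<open>\<eta> / 2\<close> leaves half the
      tolerance to the mesh.\<close>
    define \<rho> where "\<rho> = min (min (\<eta> / 2) 1) (min a (T - b))"
    have \<rho>: "0 < \<rho>" "\<rho> \<le> 1" "\<rho> \<le> a" "b \<le> T - \<rho>" "\<rho> \<le> \<eta> / 2"
      unfolding \<rho>_def using \<eta> ab by linarith+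
    \<comment> \<open>\<open>C + 1\<close> avoids division by 0 and makes
      \<open>4 * \<epsilon> * C < \<rho>\<^sup>2\<close> strict.\<close>
    define \<epsilon> where "\<epsilon> = \<rho>\<^sup>2 / (4 * (C + 1))"
    have \<epsilon>: "0 < \<epsilon>" "4 * \<epsilon> * C < \<rho>\<^sup>2"
      unfolding \<epsilon>_def using \<rho>(1) C(1) by (auto simp: field_simps)
    define c where "c = (b - a) * (1 + M\<^sup>2) / (2 * \<epsilon>)"
    have c: "0 < c" unfolding c_def using ab \<epsilon> by (intro divide_pos_pos mult_pos_pos) (auto simp: add_pos_nonneg)
    \<comment> \<open>The first bound gives \<open>h * (M + 1) \<le> \<eta> / 2\<close>; the second
      limits the total rise \<open>h * c\<close> to half of \<open>- v a x\<close>.\<close>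
    define h0 where "h0 = min (\<eta> / (2 * (M + 1))) (- v a x / (2 * c))"
    have h0: "0 < h0" unfolding h0_def using \<eta> M0 neg c by (auto simp: divide_neg_pos)
    obtain N where N: "(b - a) / h0 < real N" using reals_Archimedean2 by blast
    have N0: "0 < real N" using N h0 ab by (smt (verit) divide_pos_pos)
    define h where "h = (b - a) / real N"
    have h: "0 < h" "b = a + real N * h" unfolding h_def using N0 ab by auto
    have hh0: "h \<le> h0" unfolding h_def using N N0 h0 by (simp add: field_simps)
    have "h * (M + 1) \<le> \<eta> / 2"
      using hh0 M0 unfolding h0_def by (simp add: field_simps)
    then have h_small: "M * h + h \<le> \<eta> / 2" by (simp add: algebra_simps)
    have Mh: "0 \<le> M * h" using M0 h by simp
    have "h * c \<le> - v a x / 2"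
      using hh0 c unfolding h0_def by (simp add: field_simps)
    then have small: "v a x + (b - a) * h * (1 + M\<^sup>2) / (2 * \<epsilon>) < 0"
      using neg unfolding c_def by (simp add: mult_ac)
    obtain X w where X: "X 0 = x" "\<And>k. X (Suc k) = X k + h *\<^sub>R w k" and
      w: "\<And>k. k \<le> N \<Longrightarrow> norm (w k) \<le> M \<and> (\<exists>s y u. s \<in> {0..T} \<and> \<bar>s - (a + real k * h)\<bar> < \<rho> \<and>
        norm (y - X k) < \<rho> \<and> u \<in> U \<and> v s y < 0 \<and> w k = f s y u)"
    proof (rule euler_chain[where A = A and C = C and ?r0.0 = r0 and ?R0.0 = R0 and M = M and x = x
            and \<epsilon> = \<epsilon> and \<rho> = \<rho> and a = a and b = b and h = h and N = N])
      show "norm (f s x u) \<le> A + L * norm x" if "s \<in> {0..T}" "u \<in> U" for s x u using A(2) that .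
      show "\<bar>v s y\<bar> \<le> C" if "s \<in> {0..T}" "norm y \<le> R0 + 1" for s y using C(2) that .
    qed (rule A(1) R0_def M_def \<epsilon> \<rho>(1,2,3,4) h x small | (rule that; assumption))+
    define Y where "Y = polygon a h N w x"
    have lip: "norm (Y s - Y r) \<le> M * \<bar>s - r\<bar>" for s r
      unfolding Y_def using h(1) M0 w by (intro polygon_Lipschitz) auto
    have node: "Y (a + real k * h) = X k" if "k \<le> N" for k
      unfolding Y_def using h(1) that X by (intro polygon_node) auto
    have "(Y r - Y s) /\<^sub>R (r - s) \<in> K" if sr: "a \<le> s" "s < r" "r \<le> b" and K: "convex K"
      and fK: "\<And>\<sigma> z u. \<lbrakk>\<sigma> \<in> {0..T}; \<bar>\<sigma> - s\<bar> \<le> (r - s) + \<eta>; norm (z - Y s) \<le> M * (r - s) + \<eta>; u \<in> U\<rbrakk>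
           \<Longrightarrow> f \<sigma> z u \<in> K" for s r K
      unfolding Y_def
    proof (rule polygon_average[OF h(1) sr(1,2) _ K])
      show "r \<le> a + real N * h" using sr h by simp
      fix k assume k: "k < N" "a + real k * h < r" "s < a + real k * h + h"
      let ?t = "a + real k * h"
      \<comment> \<open>The sample behind \<open>w k\<close> is within \<open>\<rho>\<close> of a
        node whose time lies between \<open>s - h\<close> and \<open>r\<close>; beyond the terms in
        \<open>r - s\<close> the errors are at most \<open>\<eta>\<close>.\<close>
      obtain \<sigma> y u where y: "\<sigma> \<in> {0..T}" "\<bar>\<sigma> - ?t\<bar> < \<rho>" "norm (y - X k) < \<rho>" "u \<in> U" "w k = f \<sigma> y u"
        using w[of k] k(1) by auto
      have t: "\<bar>?t - s\<bar> \<le> (r - s) + h" using k sr h(1) by linarith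
      then have "M * \<bar>?t - s\<bar> \<le> M * ((r - s) + h)" using M0 by (rule mult_left_mono)
      then have "norm (X k - Y s) \<le> M * (r - s) + M * h"
        using lip[of ?t s] node[of k] k(1) by (simp add: distrib_left)
      moreover have "norm (y - Y s) \<le> norm (y - X k) + norm (X k - Y s)"
        using norm_triangle_ineq[of "y - X k" "X k - Y s"] by simp
      ultimately have "norm (y - Y s) \<le> M * (r - s) + \<eta>" using y(3) \<rho>(5) h_small h(1) by linarith
      moreover have "\<bar>\<sigma> - s\<bar> \<le> (r - s) + \<eta>" using y(2) t \<rho>(5) h_small Mh by linarith
      ultimately show "w k \<in> K" unfolding y(5) using fK y by blast
    qed
    then have "approx_trajectory M \<eta> a b Y" unfolding approx_trajectory_def using lip by blast
    moreover have "\<forall>s\<le>a. Y s = x" unfolding Y_def using h(1) by (auto intro: polygon_before)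
    moreover have "Y b = X N" using node[of N] h(2) by simp
    moreover obtain t z where "t \<in> {0..T}" "\<bar>t - b\<bar> < \<rho>" "norm (z - X N) < \<rho>" "v t z < 0"
      using w[of N] h(2) by auto
    ultimately show "\<exists>Y t z. approx_trajectory M \<eta> a b Y \<and> (\<forall>s\<le>a. Y s = x) \<and>
      t \<in> {0..T} \<and> \<bar>t - b\<bar> \<le> \<eta> \<and> norm (z - Y b) \<le> \<eta> \<and> v t z < 0"
      using \<rho>(5) \<eta> by (intro exI[of _ Y] exI[of _ t] exI[of _ z]) auto
  qed
qed

end

section \<open>The backwards reachable set\<close>

theorem theorem3:
  fixes T :: real
    and U :: "'b::euclidean_space set"
    and f :: "real \<Rightarrow> 'a::euclidean_space \<Rightarrow> 'b \<Rightarrow> 'a"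
    and g gbar :: "'a \<Rightarrow> real"
    and vbar :: "real \<Rightarrow> 'a \<Rightarrow> real"
  assumes T_pos: "T > 0"
    and U_compact: "compact U" and U_nonempty: "U \<noteq> {}"
    and f_cont: "continuous_on ({0..T} \<times> UNIV \<times> U) (\<lambda>(s,x,u). f s x u)"
    and f_lip: "\<exists>L. \<forall>s\<in>{0..T}. \<forall>u\<in>U. \<forall>x y. norm (f s x u - f s y u) \<le> L * norm (x - y)"
    and f_convex: "\<forall>s\<in>{0..T}. \<forall>x. convex ((\<lambda>u. f s x u) ` U)"
    and g_cont: "continuous_on UNIV g"
    and v_cont: "continuous_on ({0..T} \<times> UNIV) (\<lambda>(t,x). vbar t x)"
    and v_super: "viscosity_supersolution f U {(t,x). t \<in> {0<..<T} \<and> vbar t x < 0} vbar"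
    and v_final: "\<forall>x. vbar T x = gbar x"
    and v_Z: "\<forall>t\<in>{0..T}. class_Z (vbar t)"
    and gbar_pos: "\<forall>x. \<not> g x \<le> 0 \<longrightarrow> gbar x > 0"
  shows "\<forall>t\<in>{0..T}. {x. vbar t x \<le> 0} \<subseteq> reach_set f U T g t"
proof (intro ballI subsetI)
  fix t x assume t: "t \<in> {0..T}" and "x \<in> {x. vbar t x \<le> 0}"
  then have vx: "vbar t x \<le> 0" by simp
  show "x \<in> reach_set f U T g t"
  proof (cases "t = T")
    case True
    \<comment> \<open>No time is left to move: the differential equation is required on an empty
      interval, and a constant control serves.\<close>
    obtain u0 where "u0 \<in> U" using U_nonempty by blast
    then have "(\<lambda>_. u0) \<in> controls U t T" unfolding controls_def by simp
    moreover have "is_trajectory f t T x (\<lambda>_. u0) (\<lambda>_. x)"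
      unfolding is_trajectory_def using True Lipschitz_imp_abs_continuous_on[of "\<lambda>_. x" 0] by simp
    moreover have "g x \<le> 0" using vx v_final gbar_pos True by (metis not_le)
    ultimately show ?thesis unfolding reach_set_def by blast
  next
    case False
    then have tT: "0 \<le> t" "t < T" using t by auto
    obtain L' where L': "\<And>s u x y. \<lbrakk>s \<in> {0..T}; u \<in> U\<rbrakk> \<Longrightarrow> norm (f s x u - f s y u) \<le> L' * norm (x - y)"
      using f_lip by blast
    interpret hj_supersolution T "max 1 L'" U f vbar
    proof
      show "norm (f s x u - f s y u) \<le> max 1 L' * norm (x - y)" if "s \<in> {0..T}" "u \<in> U" for s x y u
        using L'[OF that] by (rule order_trans) (simp add: mult_right_mono)
    qed (use T_pos U_compact U_nonempty f_cont f_convex v_cont v_super in auto)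
    obtain M where M: "\<And>\<eta> a b x'. \<lbrakk>0 < \<eta>; 0 < a; a < b; b < T; norm x' \<le> norm x + 1; vbar a x' < 0\<rbrakk> \<Longrightarrow>
      \<exists>Y s z. approx_trajectory M \<eta> a b Y \<and> (\<forall>s\<le>a. Y s = x') \<and>
        s \<in> {0..T} \<and> \<bar>s - b\<bar> \<le> \<eta> \<and> norm (z - Y b) \<le> \<eta> \<and> vbar s z < 0"
      using approx_trajectory_exists[of "norm x + 1"] by metis
    define \<eta> where "\<eta> n = inverse (real (Suc n))" for n
    have \<eta>: "0 < \<eta> n" "\<eta> n \<le> 1" for n unfolding \<eta>_def by (auto simp: field_simps)
    have \<eta>_lim: "\<eta> \<longlonglongrightarrow> 0" unfolding \<eta>_def by (rule LIMSEQ_inverse_real_of_nat)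
    \<comment> \<open>The polygons end before \<open>T\<close>, as the supersolution property
      concerns interior times; the factor \<open>(T - t) / 3\<close> keeps these ends after the
      starting times chosen below.\<close>
    define b where "b n = T - (T - t) / 3 * \<eta> n" for n
    have b_lim: "b \<longlonglongrightarrow> T" unfolding b_def by (rule tendsto_eq_intros \<eta>_lim refl)+ simp
    have "\<exists>a x' Y s z. t < a \<and> a < t + (T - t) / 3 * \<eta> n \<and> norm (x' - x) < \<eta> n \<and>
        approx_trajectory M (\<eta> n) a (b n) Y \<and> (\<forall>s\<le>a. Y s = x') \<and>
        s \<in> {0..T} \<and> \<bar>s - b n\<bar> \<le> \<eta> n \<and> norm (z - Y (b n)) \<le> \<eta> n \<and> vbar s z < 0" for n
    proof -
      \<comment> \<open>If \<open>vbar t x\<close> is 0, class \<open>\<Z>\<close> gives a nearby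
        point with negative value; otherwise \<open>x\<close> itself serves.\<close>
      obtain x' where x': "norm (x' - x) < \<eta> n" "vbar t x' < 0"
        using v_Z t vx \<eta>(1)[of n] unfolding class_Z_def
        by (cases "vbar t x = 0") (fastforce, metis cancel_comm_monoid_add_class.diff_cancel norm_zero order_le_less)
      define d where "d = (T - t) / 3 * \<eta> n"
      have d: "0 < d" "d \<le> (T - t) / 3" unfolding d_def using tT \<eta>[of n] mult_left_mono[of "\<eta> n" 1 "(T - t) / 3"] by auto
      have "continuous_on {0..T} (\<lambda>s. (\<lambda>(t,x). vbar t x) (s, x'))"
        by (rule continuous_on_compose2[OF v_cont]) (auto intro!: continuous_intros)
      then have "continuous (at t within {0..T}) (\<lambda>s. vbar s x')"
        using t by (simp add: continuous_on_eq_continuous_within)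
      then obtain \<delta> where \<delta>: "\<delta> > 0" "\<And>s. \<lbrakk>s \<in> {0..T}; dist s t < \<delta>\<rbrakk> \<Longrightarrow> dist (vbar s x') (vbar t x') < - vbar t x'"
        unfolding continuous_within_eps_delta using x'(2) by (metis neg_0_less_iff_less)
      \<comment> \<open>The start moves past \<open>t\<close>, which may be 0, into the open time
        interval; continuity in time keeps the value at \<open>x'\<close> negative.\<close>
      define a where "a = t + min \<delta> d / 2"
      have a: "t < a" "a < t + d" "a - t < \<delta>" unfolding a_def using d(1) \<delta>(1) by linarith+
      have "b n = T - d" unfolding b_def d_def ..
      then have ab: "0 < a" "a < b n" "b n < T" using a d tT by auto
      have "vbar a x' < 0" using \<delta>(2)[of a] a ab by (simp add: dist_real_def abs_less_iff)
      moreover have "norm x' \<le> norm x + 1"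
        using x'(1) \<eta>(2)[of n] norm_triangle_sub[of x' x] by linarith
      ultimately show ?thesis using M[OF \<eta>(1) ab] a(1) a(2)[unfolded d_def] x'(1) by blast
    qed
    then obtain a x' Y s z where seq: "\<And>n. t < a n" "\<And>n. a n < t + (T - t) / 3 * \<eta> n"
      "\<And>n. norm (x' n - x) < \<eta> n" "\<And>n. approx_trajectory M (\<eta> n) (a n) (b n) (Y n)"
      "\<And>n r. r \<le> a n \<Longrightarrow> Y n r = x' n" "\<And>n. s n \<in> {0..T}" "\<And>n. \<bar>s n - b n\<bar> \<le> \<eta> n"
      "\<And>n. norm (z n - Y n (b n)) \<le> \<eta> n" "\<And>n. vbar (s n) (z n) < 0"
      by metis
    have a_lim: "a \<longlonglongrightarrow> t"
    proof (rule tendsto_sandwich[OF _ _ tendsto_const])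
      show "(\<lambda>n. t + (T - t) / 3 * \<eta> n) \<longlonglongrightarrow> t" by (rule tendsto_eq_intros \<eta>_lim refl)+ simp
      show "\<forall>\<^sub>F n in sequentially. t \<le> a n" using seq(1) by (simp add: less_imp_le)
      show "\<forall>\<^sub>F n in sequentially. a n \<le> t + (T - t) / 3 * \<eta> n"
        by (intro always_eventually allI less_imp_le seq(2))
    qed
    \<comment> \<open>The polygons are constant up to \<open>a n\<close>, so at the earlier time
      \<open>t\<close> they are still at their starting points.\<close>
    have "(\<lambda>n. Y n t) = x'" using seq(5)[OF less_imp_le[OF seq(1)]] by auto
    moreover have "x' \<longlonglongrightarrow> x"
      by (rule LIM_zero_cancel, rule Lim_null_comparison[OF _ \<eta>_lim]) (intro always_eventually allI less_imp_le seq(3))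
    ultimately have init: "(\<lambda>n. Y n t) \<longlonglongrightarrow> x" by simp
    obtain u y k where u: "u \<in> controls U t T" and y: "is_trajectory f t T x u y"
      and k: "strict_mono (k :: nat \<Rightarrow> nat)" and YT: "(\<lambda>n. Y (k n) T) \<longlonglongrightarrow> y T"
      using approx_trajectories_limit[OF tT \<eta>_lim a_lim b_lim seq(4) init] by metis
    \<comment> \<open>The points \<open>z n\<close>, where \<open>vbar\<close> is negative, are
      close to \<open>Y n (b n)\<close>; the common Lipschitz constant carries this over to
      \<open>Y n T\<close>.\<close>
    have "(\<lambda>n. z n - Y n T) \<longlonglongrightarrow> 0"
    proof (rule Lim_null_comparison)
      show "\<forall>\<^sub>F n in sequentially. norm (z n - Y n T) \<le> \<eta> n + M * \<bar>b n - T\<bar>"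
      proof (rule always_eventually, rule allI)
        fix n
        have "norm (Y n (b n) - Y n T) \<le> M * \<bar>b n - T\<bar>"
          using seq(4)[of n] unfolding approx_trajectory_def by blast
        then show "norm (z n - Y n T) \<le> \<eta> n + M * \<bar>b n - T\<bar>"
          using seq(8)[of n] norm_triangle_ineq[of "z n - Y n (b n)" "Y n (b n) - Y n T"] by simp
      qed
      show "(\<lambda>n. \<eta> n + M * \<bar>b n - T\<bar>) \<longlonglongrightarrow> 0"
        by (rule tendsto_eq_intros \<eta>_lim b_lim refl)+ simp
    qed
    from tendsto_add[OF LIMSEQ_subseq_LIMSEQ[OF this k] YT]
    have z_lim: "(\<lambda>n. z (k n)) \<longlonglongrightarrow> y T" by (simp add: o_def)
    have "(\<lambda>n. s n - b n) \<longlonglongrightarrow> 0"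
      by (rule Lim_null_comparison[OF _ \<eta>_lim]) (use seq(7) in auto)
    from tendsto_add[OF this b_lim] have "s \<longlonglongrightarrow> T" by simp
    then have "(\<lambda>n. (s (k n), z (k n))) \<longlonglongrightarrow> (T, y T)"
      using LIMSEQ_subseq_LIMSEQ[OF _ k, of s T] by (intro tendsto_Pair z_lim) (simp add: o_def)
    then have "(\<lambda>n. (\<lambda>(t,x). vbar t x) (s (k n), z (k n))) \<longlonglongrightarrow> (\<lambda>(t,x). vbar t x) (T, y T)"
      by (rule continuous_on_tendsto_compose[OF v_cont]) (use seq(6) T_pos in auto)
    \<comment> \<open>The strict sign weakens to \<open>\<le> 0\<close> in the limit, which suffices
      because \<open>gbar\<close> is positive wherever \<open>g\<close> is.\<close>
    then have "vbar T (y T) \<le> 0"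
      using seq(9) by (intro LIMSEQ_le_const2[where X = "\<lambda>n. vbar (s (k n)) (z (k n))"])
        (auto intro: less_imp_le)
    then have "g (y T) \<le> 0" using v_final gbar_pos by (metis not_le)
    then show ?thesis unfolding reach_set_def using u y by blast
  qed
qed

end
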